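(* Fix an integer $K\ge 2$ and a constant $C>1$. For sequences $\theta=\theta_n$, $\rho=\rho_n$ with $0<\rho_n<\theta_n\le \tfrac12$, let $\mathcal Y$ be the adjacency matrix of a random graph drawn from $\mathrm{SBM}(n,K,\theta_n,\rho_n)$, and say that a one-step algorithm achieves consistent exact recovery if there are thresholds $\lambda=\lambda_n$ such that its output $W$ satisfies $$\mathbb P\big(\forall\, i,j:\ W_{ij}=W^*_{ij}\big)\longrightarrow 1\qquad (n\to\infty).$$ There is a constant $c>0$ (depending only on $K$ and $C$) such that the following hold. (1) Suppose $\theta_n/\rho_n= C$ for all $n$. (a) If $c\,\theta_n> n^{-1/2}$ for all $n$, then $\mathrm{AWCD}_1^\circ$ achieves consistent exact recovery. (b) If $c\,\theta_n> n^{-2/3}(\log n)^{1/3}$ for all $n$, then $\mathrm{AWCD}_1$ achieves consistent exact recovery. (2) Suppose $\theta_n/\rho_n\le C$ for all $n$. (a) If $c\,(\theta_n-\rho_n)>\max\{n^{-1/3}\theta_n^{1/3},\ n^{-1/6}\theta_n^{5/6}(\log n)^{1/6}\}$ for all $n$, then $\mathrm{AWCD}_1^\circ$ achieves consistent exact recovery. (b) If $c\,(\theta_n-\rho_n)>\max\{n^{-1/3}\theta_n^{1/2}(\log n)^{1/6},\ n^{-1/6}\theta_n^{5/6}(\log n)^{1/6}\}$ for all $n$, then $\mathrm{AWCD}_1$ achieves consistent exact recovery.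
   Context: Model. $\mathrm{SBM}(n,K,\theta,\rho)$ is the random simple undirected graph on $nK$ vertices partitioned into $K$ communities $\mathcal C_1^*,\dots,\mathcal C_K^*$ of size $n$ each, whose edges are independent Bernoulli variables with mean $\theta$ for pairs of distinct vertices in the same community and mean $\rho$ for pairs in different communities. $\mathcal Y$ is its symmetric $0/1$ adjacency matrix (zero diagonal). $W^*_{ij}=1$ if $i,j$ belong to the same community and $W^*_{ij}=0$ otherwise. Algorithms (one step, input $\mathcal Y$ and a threshold $\lambda\in\mathbb R$). Let $\mathcal C_i=\{j:\mathcal Y_{ij}=1\}$ be the neighborhood of vertex $i$. For all vertices $i,j$ define $$N_{ij}=|\mathcal C_i|\,\big(|\mathcal C_j|-\mathbb 1(i=j)\big),$$ and - for $\mathrm{AWCD}_1^\circ$ (original version): $S_{ij}=(\mathcal Y\mathcal Y\mathcal Y)_{ij}$; - for $\mathrm{AWCD}_1$ (bias-corrected version): $S_{ij}=(\mathcal Y\mathcal Y\mathcal Y)_{ij}-\mathbb 1(\mathcal Y_{ij}=1)\,(|\mathcal C_i|+|\mathcal C_j|-1)$, which equals $\sum_{k,l\notin\{i,j\}}\mathcal Y_{il}\mathcal Y_{lk}\mathcal Y_{kj}$ for $i\ne j$. Then set $\widetilde\theta_{ij}=S_{ij}/N_{ij}$, $$\widetilde\theta_{i\lor j}=\frac{S_{ii}+2S_{ij}+S_{jj}}{N_{ii}+2N_{ij}+N_{jj}},$$ $$T_{ij}=N_{ii}\,\mathcal K(\widetilde\theta_{ii},\widetilde\theta_{i\lor j})+N_{jj}\,\mathcal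 K(\widetilde\theta_{jj},\widetilde\theta_{i\lor j})+N_{ij}\,\mathcal K(\widetilde\theta_{ij},\widetilde\theta_{i\lor j}),$$ where $\mathcal K(p,q)=p\log\frac pq+(1-p)\log\frac{1-p}{1-q}$ is the Kullback–Leibler divergence between Bernoulli distributions with means $p$ and $q$ ($0\log 0=0$). Output: $W_{ij}=\mathbb 1(T_{ij}\le\lambda)$. Convention: if $T_{ij}$ is undefined (a denominator vanishes or an estimator lies outside $[0,1]$), put $T_{ij}=0$. The threshold $\lambda_n$ may depend on $n$ and on the model parameters. *)

theory Defs
  imports "HOL-Probability.Probability"
begin

text \<open>
  Vertices are the natural numbers below \<open>m\<close>, and an \<open>m \<times> m\<close> matrix is a function
  \<open>nat \<Rightarrow> nat \<Rightarrow> real\<close> of which only the entries with both indices below \<open>m\<close> matter.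
  A partition into communities is given by a labelling \<open>z\<close> of the vertices.
\<close>

definition balanced_communities :: "nat \<Rightarrow> nat \<Rightarrow> (nat \<Rightarrow> nat) \<Rightarrow> bool" where
  "balanced_communities n K z \<longleftrightarrow>
     z ` {..<n * K} \<subseteq> {..<K} \<and> (\<forall>k<K. card {i \<in> {..<n * K}. z i = k} = n)"

definition Wstar :: "(nat \<Rightarrow> nat) \<Rightarrow> nat \<Rightarrow> nat \<Rightarrow> real" where
  "Wstar z i j = of_bool (z i = z j)"

text \<open>
  Distribution of the adjacency matrix. The independent edge indicators are indexed by the
  two-element sets of vertices; the default value \<^const>\<open>False\<close> of the product at all other
  sets, in particular at \<open>{i, i} = {i}\<close>, gives the zero diagonal.
\<close>

definition SBM :: "nat \<Rightarrow> nat \<Rightarrow> (nat \<Rightarrow> nat) \<Rightarrow> real \<Rightarrow> real \<Rightarrow> (nat \<Rightarrow> nat \<Rightarrow> real) pmf" where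
  "SBM n K z \<theta> \<rho> =
     map_pmf (\<lambda>x i j. of_bool (x {i, j}))
       (Pi_pmf {e. e \<subseteq> {..<n * K} \<and> card e = 2} False
          (\<lambda>e. bernoulli_pmf (if \<forall>i\<in>e. \<forall>j\<in>e. z i = z j then \<theta> else \<rho>)))"

definition nbhd :: "nat \<Rightarrow> (nat \<Rightarrow> nat \<Rightarrow> real) \<Rightarrow> nat \<Rightarrow> nat set" where
  "nbhd m Y i = {j \<in> {..<m}. Y i j = 1}"

definition Ncount :: "nat \<Rightarrow> (nat \<Rightarrow> nat \<Rightarrow> real) \<Rightarrow> nat \<Rightarrow> nat \<Rightarrow> real" where
  "Ncount m Y i j = real (card (nbhd m Y i)) * (real (card (nbhd m Y j)) - of_bool (i = j))"

text \<open>The entry \<open>(i, j)\<close> of the matrix product \<open>Y Y Y\<close>.\<close>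

definition S_orig :: "nat \<Rightarrow> (nat \<Rightarrow> nat \<Rightarrow> real) \<Rightarrow> nat \<Rightarrow> nat \<Rightarrow> real" where
  "S_orig m Y i j = (\<Sum>l<m. \<Sum>k<m. Y i l * Y l k * Y k j)"

definition S_corr :: "nat \<Rightarrow> (nat \<Rightarrow> nat \<Rightarrow> real) \<Rightarrow> nat \<Rightarrow> nat \<Rightarrow> real" where
  "S_corr m Y i j = S_orig m Y i j -
     of_bool (Y i j = 1) * (real (card (nbhd m Y i)) + real (card (nbhd m Y j)) - 1)"

text \<open>In the next definition \<open>0 * ln _ = 0\<close> is the convention \<open>0 log 0 = 0\<close>.\<close>

definition KL_bernoulli :: "real \<Rightarrow> real \<Rightarrow> real" where
  "KL_bernoulli p q = p * ln (p / q) + (1 - p) * ln ((1 - p) / (1 - q))"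

text \<open>
  The remaining definitions take the statistic \<open>S\<close> (that is, \<open>S_orig m Y\<close> or \<open>S_corr m Y\<close>)
  as an argument.
\<close>

definition theta_est ::
    "nat \<Rightarrow> (nat \<Rightarrow> nat \<Rightarrow> real) \<Rightarrow> (nat \<Rightarrow> nat \<Rightarrow> real) \<Rightarrow> nat \<Rightarrow> nat \<Rightarrow> real" where
  "theta_est m Y S i j = S i j / Ncount m Y i j"

definition theta_join ::
    "nat \<Rightarrow> (nat \<Rightarrow> nat \<Rightarrow> real) \<Rightarrow> (nat \<Rightarrow> nat \<Rightarrow> real) \<Rightarrow> nat \<Rightarrow> nat \<Rightarrow> real" where
  "theta_join m Y S i j =
     (S i i + 2 * S i j + S j j) / (Ncount m Y i i + 2 * Ncount m Y i j + Ncount m Y j j)"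

text \<open>
  The test statistic is well defined if no denominator vanishes and all estimators are in
  \<open>[0, 1]\<close>. In that case \<open>theta_join\<close> is a weighted mean of the other three estimators with
  positive weights, so it is 0 (or 1) only if all of them are, and no infinite divergence occurs.
\<close>

definition T_defined ::
    "nat \<Rightarrow> (nat \<Rightarrow> nat \<Rightarrow> real) \<Rightarrow> (nat \<Rightarrow> nat \<Rightarrow> real) \<Rightarrow> nat \<Rightarrow> nat \<Rightarrow> bool" where
  "T_defined m Y S i j \<longleftrightarrow>
     Ncount m Y i i \<noteq> 0 \<and> Ncount m Y j j \<noteq> 0 \<and> Ncount m Y i j \<noteq> 0 \<and>
     Ncount m Y i i + 2 * Ncount m Y i j + Ncount m Y j j \<noteq> 0 \<and>
     theta_est m Y S i i \<in> {0..1} \<and> theta_est m Y S j j \<in> {0..1} \<and>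
     theta_est m Y S i j \<in> {0..1} \<and> theta_join m Y S i j \<in> {0..1}"

definition T_stat ::
    "nat \<Rightarrow> (nat \<Rightarrow> nat \<Rightarrow> real) \<Rightarrow> (nat \<Rightarrow> nat \<Rightarrow> real) \<Rightarrow> nat \<Rightarrow> nat \<Rightarrow> real" where
  "T_stat m Y S i j =
     (if T_defined m Y S i j then
        Ncount m Y i i * KL_bernoulli (theta_est m Y S i i) (theta_join m Y S i j) +
        Ncount m Y j j * KL_bernoulli (theta_est m Y S j j) (theta_join m Y S i j) +
        Ncount m Y i j * KL_bernoulli (theta_est m Y S i j) (theta_join m Y S i j)
      else 0)"

definition AWCD1_orig :: "nat \<Rightarrow> (nat \<Rightarrow> nat \<Rightarrow> real) \<Rightarrow> real \<Rightarrow> nat \<Rightarrow> nat \<Rightarrow> real" where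
  "AWCD1_orig m Y lam i j = of_bool (T_stat m Y (S_orig m Y) i j \<le> lam)"

definition AWCD1 :: "nat \<Rightarrow> (nat \<Rightarrow> nat \<Rightarrow> real) \<Rightarrow> real \<Rightarrow> nat \<Rightarrow> nat \<Rightarrow> real" where
  "AWCD1 m Y lam i j = of_bool (T_stat m Y (S_corr m Y) i j \<le> lam)"

text \<open>
  The thresholds may depend on \<open>n\<close> and on the parameters \<open>K\<close>, \<open>\<theta>\<close>, \<open>\<rho>\<close>, but not on the
  unknown communities \<open>z\<close>.
\<close>

definition consistent_exact_recovery ::
    "(nat \<Rightarrow> (nat \<Rightarrow> nat \<Rightarrow> real) \<Rightarrow> real \<Rightarrow> nat \<Rightarrow> nat \<Rightarrow> real) \<Rightarrow>
     nat \<Rightarrow> (nat \<Rightarrow> real) \<Rightarrow> (nat \<Rightarrow> real) \<Rightarrow> bool" where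
  "consistent_exact_recovery alg K \<theta> \<rho> \<longleftrightarrow>
     (\<exists>lam :: nat \<Rightarrow> real. \<forall>z :: nat \<Rightarrow> nat \<Rightarrow> nat.
        (\<forall>n. balanced_communities n K (z n)) \<longrightarrow>
        (\<lambda>n. measure_pmf.prob (SBM n K (z n) (\<theta> n) (\<rho> n))
               {Y. \<forall>i<n * K. \<forall>j<n * K. alg (n * K) Y (lam n) i j = Wstar (z n) i j})
          \<longlonglongrightarrow> 1)"

end

theory Submission
  imports Defs
begin

text \<open>
  Write \<open>s = \<theta> + (K - 1) \<rho>\<close>. Given the neighbourhoods of \<open>i\<close> and \<open>j\<close>, the statistic \<open>S\<^sub>i\<^sub>j\<close> counts edges
  between two sets of about \<open>n s\<close> vertices whose community compositions are known up to noise,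
  so \<open>S\<^sub>i\<^sub>j / N\<^sub>i\<^sub>j\<close> is close to a density that depends only on whether \<open>i\<close> and \<open>j\<close> share a
  community. The two possible densities differ by \<open>D = (\<theta> - \<rho>)\<^sup>3 / s\<^sup>2\<close>. There are three sources
  of noise: the composition of the neighbourhoods, of order at most \<open>sqrt (\<theta> log n / n)\<close>; the
  edges between them, of order \<open>sqrt (log n) / (n sqrt \<theta>)\<close>; and, for the uncorrected
  statistic, the walks through the edge \<open>{i, j}\<close>, of order \<open>1 / (n \<theta>)\<close>. The separation
  conditions say that \<open>D\<close> exceeds each of them by a large constant factor, which can be made as
  large as needed by taking \<open>c\<close> small. Bernstein's inequality and a union bound make all estimators
  accurate up to a small multiple of \<open>D\<close> simultaneously, and since the Kullback-Leibler
  divergence is comparable to \<open>(p - q)\<^sup>2 / \<theta>\<close>, the statistic \<open>T\<^sub>i\<^sub>j\<close> is below or above a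
  threshold of order \<open>n\<^sup>2 \<theta> D\<^sup>2\<close> according to the communities.
\<close>

section \<open>Divergence and concentration inequalities\<close>

text \<open>The bound \<open>ln t \<le> t - 1\<close> in both terms gives the chi-square divergence,
  which for Bernoulli laws is the right-hand side. The case \<open>p = 0\<close> or
  \<open>p = 1\<close> fits because \<open>0 * ln _ = 0\<close>.\<close>

lemma KL_bernoulli_le:
  assumes p: "0 \<le> p" "p \<le> 1" and q: "0 < q" "q < 1"
  shows "KL_bernoulli p q \<le> (p - q)\<^sup>2 / (q * (1 - q))"
proof -
  have *: "x * ln (x / y) \<le> x * (x / y - 1)" if "0 \<le> x" "0 < y" for x y :: real
    using that by (cases "x = 0") (auto intro!: mult_left_mono ln_le_minus_one)
  have "KL_bernoulli p q \<le> p * (p / q - 1) + (1 - p) * ((1 - p) / (1 - q) - 1)"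
    unfolding KL_bernoulli_def using p q by (intro add_mono *) auto
  also have "\<dots> = (p - q)\<^sup>2 / (q * (1 - q))"
    using q by (simp add: divide_simps) (simp add: algebra_simps power2_eq_square)
  finally show ?thesis .
qed

text \<open>The divergence dominates the squared Hellinger distance, which retains the factor
  \<open>1 / max p q\<close> that Pinsker's inequality loses.\<close>

lemma KL_bernoulli_ge:
  assumes p: "0 \<le> p" "p \<le> 1" and q: "0 < q" "q < 1"
    and b: "p \<le> b" "q \<le> b"
  shows "(p - q)\<^sup>2 / (4 * b) \<le> KL_bernoulli p q"
proof -
  \<comment> \<open>Apply \<open>ln t \<le> t - 1\<close> to \<open>t = sqrt y / sqrt x\<close>.
    Adding the instances for \<open>p, q\<close> and for \<open>1 - p, 1 - q\<close> produces the
    squared Hellinger distance.\<close>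
  have *: "2 * x - 2 * (sqrt x * sqrt y) \<le> x * ln (x / y)" if "0 \<le> x" "0 < y" for x y :: real
  proof (cases "x = 0")
    case False
    with that have x: "x > 0" by simp
    have "ln (x / y) = - 2 * ln (sqrt y / sqrt x)"
      using x that by (simp add: ln_div ln_sqrt)
    moreover have "ln (sqrt y / sqrt x) \<le> sqrt y / sqrt x - 1"
      using x that by (intro ln_le_minus_one) simp
    ultimately have "ln (x / y) \<ge> 2 - 2 * (sqrt y / sqrt x)" by linarith
    hence "x * ln (x / y) \<ge> x * (2 - 2 * (sqrt y / sqrt x))"
      using x by (intro mult_left_mono) auto
    moreover have "x * (2 - 2 * (sqrt y / sqrt x)) = 2 * x - 2 * (x / sqrt x) * sqrt y"
      by (simp add: algebra_simps)
    moreover have "x / sqrt x = sqrt x"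
      using x by (simp add: real_div_sqrt)
    ultimately show ?thesis by simp
  qed simp
  have ident: "(sqrt x - sqrt y)\<^sup>2 = x + y - 2 * (sqrt x * sqrt y)" if "0 \<le> x" "0 \<le> y" for x y
    using that by (simp add: power2_diff)
  have "b > 0" using q b by simp
  have "(sqrt p - sqrt q)\<^sup>2 + (sqrt (1 - p) - sqrt (1 - q))\<^sup>2 =
        (2 * p - 2 * (sqrt p * sqrt q)) + (2 * (1 - p) - 2 * (sqrt (1 - p) * sqrt (1 - q)))"
    using p q by (simp add: ident)
  also have "\<dots> \<le> KL_bernoulli p q"
    unfolding KL_bernoulli_def using p q by (intro add_mono *) auto
  finally have hell: "(sqrt p - sqrt q)\<^sup>2 \<le> KL_bernoulli p q"
    using zero_le_power2[of "sqrt (1 - p) - sqrt (1 - q)"] by linarith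
  \<comment> \<open>The factor \<open>p - q = (sqrt p - sqrt q) * (sqrt p + sqrt q)\<close> turns a
    Hellinger bound into one on \<open>p - q\<close>; the second factor costs at most
    \<open>2 * sqrt b\<close>.\<close>
  have "(sqrt p + sqrt q)\<^sup>2 \<le> (2 * sqrt b)\<^sup>2"
  proof (rule power_mono)
    show "sqrt p + sqrt q \<le> 2 * sqrt b"
      using real_sqrt_le_mono[OF b(1)] real_sqrt_le_mono[OF b(2)] by linarith
  qed (use p q in simp)
  also have "\<dots> = 4 * b" using \<open>b > 0\<close> by (simp add: power_mult_distrib)
  finally have s: "(sqrt p + sqrt q)\<^sup>2 \<le> 4 * b" .
  have "(sqrt p - sqrt q) * (sqrt p + sqrt q) = p - q"
    using p q by (simp add: algebra_simps)
  hence "(p - q)\<^sup>2 = (sqrt p - sqrt q)\<^sup>2 * (sqrt p + sqrt q)\<^sup>2"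
    by (metis power_mult_distrib)
  also have "\<dots> \<le> (sqrt p - sqrt q)\<^sup>2 * (4 * b)"
    using s by (intro mult_left_mono) auto
  finally have "(p - q)\<^sup>2 / (4 * b) \<le> (sqrt p - sqrt q)\<^sup>2"
    using \<open>b > 0\<close> by (simp add: divide_simps mult.commute)
  with hell show ?thesis by linarith
qed

section \<open>Bernstein bound for weighted Bernoulli sums\<close>

text \<open>For negative \<open>x = - y\<close>, multiply by \<open>1 + y\<close>: the product
  \<open>(1 - y + y^2) * (1 + y) = 1 + y^3\<close> is at least 1, and
  \<open>1 + y \<le> exp y\<close>.\<close>

lemma exp_le_quadratic:
  fixes x :: real
  assumes "\<bar>x\<bar> \<le> 1"
  shows "exp x \<le> 1 + x + x\<^sup>2"
proof (cases "x \<ge> 0")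
  case True
  with assms show ?thesis by (intro exp_bound) auto
next
  case False
  define y where "y = - x"
  have y: "0 \<le> y" using False by (simp add: y_def)
  have "(1 + x + x\<^sup>2) * (1 + y) = 1 + y ^ 3"
    by (simp add: y_def algebra_simps power2_eq_square power3_eq_cube)
  hence "1 \<le> (1 + x + x\<^sup>2) * (1 + y)" using y by simp
  also have "\<dots> \<le> (1 + x + x\<^sup>2) * exp y"
    using assms y exp_ge_add_one_self[of y] by (intro mult_left_mono) (auto simp: add.commute)
  finally show ?thesis by (simp add: y_def exp_minus divide_simps)
qed

text \<open>The variance proxy is of order \<open>p\<close> instead of a constant, which keeps the
  later bounds sharp for sparse graphs.\<close>

lemma bernoulli_mgf_le:
  assumes "0 \<le> p" "p \<le> 1" "\<bar>a\<bar> \<le> 1"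
  shows "measure_pmf.expectation (bernoulli_pmf p) (\<lambda>b. exp (a * (of_bool b - p))) \<le> exp (a\<^sup>2 * p)"
proof -
  have "measure_pmf.expectation (bernoulli_pmf p) (\<lambda>b. exp (a * (of_bool b - p)))
      = p * exp (a * (1 - p)) + (1 - p) * exp (- a * p)"
    using assms by simp
  also have "\<dots> = (1 + p * (exp a - 1)) * exp (- a * p)"
    by (simp add: algebra_simps flip: exp_add)
  also have "\<dots> \<le> exp (p * (exp a - 1)) * exp (- a * p)"
    using exp_ge_add_one_self[of "p * (exp a - 1)"] by (intro mult_right_mono) auto
  also have "\<dots> = exp (p * (exp a - 1 - a))"
    by (simp add: algebra_simps flip: exp_add)
  also have "\<dots> \<le> exp (p * a\<^sup>2)"
    using assms exp_le_quadratic[of a] by (simp add: mult_left_mono)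
  finally show ?thesis by (simp add: mult.commute)
qed

text \<open>Chernoff's method with a quadratic bound on each factor. Weights up to 2 are allowed
  because an edge inside the overlap of two vertex sets is counted from both ends. The restriction
  \<open>t \<le> V\<close> keeps the bound in the Gaussian regime.\<close>

lemma bernoulli_sum_tail:
  fixes w p :: "'a \<Rightarrow> real"
  assumes fin: "finite E" and p: "\<And>e. e \<in> E \<Longrightarrow> 0 \<le> p e \<and> p e \<le> 1"
    and w: "\<And>e. e \<in> E \<Longrightarrow> \<bar>w e\<bar> \<le> 2"
    and V: "(\<Sum>e\<in>E. (w e)\<^sup>2 * p e) \<le> V" "0 < V" and t: "0 \<le> t" "t \<le> V"
  shows "measure_pmf.prob (Pi_pmf E d (\<lambda>e. bernoulli_pmf (p e)))
           {x. t \<le> (\<Sum>e\<in>E. w e * (of_bool (x e) - p e))} \<le> exp (- t\<^sup>2 / (4 * V))"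
proof -
  let ?P = "Pi_pmf E d (\<lambda>e. bernoulli_pmf (p e))"
  \<comment> \<open>This minimises \<open>s^2 * V - s * t\<close>. From \<open>t \<le> V\<close>
    follows \<open>s \<le> 1 / 2\<close>, so every exponent \<open>s * w e\<close> stays in the
    range of the quadratic bound.\<close>
  define s where "s = t / (2 * V)"
  have s: "0 \<le> s" "s \<le> 1 / 2" using V t by (auto simp: s_def divide_simps)
  have sw: "\<bar>s * w e\<bar> \<le> 1" if "e \<in> E" for e
  proof -
    have "\<bar>s * w e\<bar> = s * \<bar>w e\<bar>" using s by (simp add: abs_mult)
    also have "\<dots> \<le> (1 / 2) * 2" using s w[OF that] by (intro mult_mono) auto
    finally show ?thesis by simp
  qed
  define f where "f = (\<lambda>x. exp (s * (\<Sum>e\<in>E. w e * (of_bool (x e) - p e))))"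
  have f_prod: "f = (\<lambda>x. \<Prod>e\<in>E. exp (s * w e * (of_bool (x e) - p e)))"
    by (simp add: f_def exp_sum[OF fin] sum_distrib_left mult.assoc)
  have int: "integrable (measure_pmf (bernoulli_pmf q)) g" for q and g :: "bool \<Rightarrow> real"
    by (rule integrable_measure_pmf_finite) simp
  have intf: "integrable (measure_pmf ?P) f"
    unfolding f_prod using int by (rule integrable_prod_Pi_pmf[OF fin])
  have "measure_pmf.expectation ?P f =
      (\<Prod>e\<in>E. measure_pmf.expectation (bernoulli_pmf (p e)) (\<lambda>b. exp (s * w e * (of_bool b - p e))))"
    unfolding f_prod by (subst expectation_prod_Pi_pmf[OF fin]) (use int in auto)
  also have "\<dots> \<le> (\<Prod>e\<in>E. exp ((s * w e)\<^sup>2 * p e))"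
    using p sw by (intro prod_mono conjI bernoulli_mgf_le integral_nonneg_AE) auto
  also have "\<dots> = exp (s\<^sup>2 * (\<Sum>e\<in>E. (w e)\<^sup>2 * p e))"
    by (simp add: exp_sum[OF fin] sum_distrib_left power_mult_distrib mult.assoc)
  also have "\<dots> \<le> exp (s\<^sup>2 * V)" using V by (simp add: mult_left_mono)
  finally have mgf: "measure_pmf.expectation ?P f \<le> exp (s\<^sup>2 * V)" .
  have "measure_pmf.prob ?P {x. t \<le> (\<Sum>e\<in>E. w e * (of_bool (x e) - p e))}
      \<le> measure_pmf.prob ?P {x \<in> space (measure_pmf ?P). exp (s * t) \<le> f x}"
    using s by (intro measure_pmf.finite_measure_mono) (auto simp: f_def intro: mult_left_mono)
  also have "\<dots> \<le> measure_pmf.expectation ?P f / exp (s * t)"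
    using intf by (intro integral_Markov_inequality_measure[where A = "{}"]) (auto simp: f_def)
  also have "\<dots> \<le> exp (s\<^sup>2 * V) / exp (s * t)"
    using mgf by (simp add: divide_right_mono)
  also have "\<dots> = exp (s\<^sup>2 * V - s * t)" by (simp add: exp_diff)
  also have "s\<^sup>2 * V - s * t = - t\<^sup>2 / (4 * V)"
    using V by (simp add: s_def power2_eq_square field_simps)
  finally show ?thesis .
qed

lemma bernoulli_sum_concentration:
  fixes w p :: "'a \<Rightarrow> real"
  assumes fin: "finite E" and p: "\<And>e. e \<in> E \<Longrightarrow> 0 \<le> p e \<and> p e \<le> 1"
    and w: "\<And>e. e \<in> E \<Longrightarrow> \<bar>w e\<bar> \<le> 2"
    and V: "(\<Sum>e\<in>E. (w e)\<^sup>2 * p e) \<le> V" "0 < V" and t: "0 \<le> t" "t \<le> V"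
  shows "measure_pmf.prob (Pi_pmf E d (\<lambda>e. bernoulli_pmf (p e)))
           {x. t \<le> \<bar>\<Sum>e\<in>E. w e * (of_bool (x e) - p e)\<bar>} \<le> 2 * exp (- t\<^sup>2 / (4 * V))"
proof -
  let ?P = "Pi_pmf E d (\<lambda>e. bernoulli_pmf (p e))"
  let ?T = "\<lambda>w. {x. t \<le> (\<Sum>e\<in>E. w e * (of_bool (x e) - p e))}"
  have "{x. t \<le> \<bar>\<Sum>e\<in>E. w e * (of_bool (x e) - p e)\<bar>} \<subseteq> ?T w \<union> ?T (\<lambda>e. - w e)"
    by (auto simp: sum_negf abs_if split: if_splits)
  hence "measure_pmf.prob ?P {x. t \<le> \<bar>\<Sum>e\<in>E. w e * (of_bool (x e) - p e)\<bar>}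
      \<le> measure_pmf.prob ?P (?T w \<union> ?T (\<lambda>e. - w e))"
    by (intro measure_pmf.finite_measure_mono) auto
  also have "\<dots> \<le> measure_pmf.prob ?P (?T w) + measure_pmf.prob ?P (?T (\<lambda>e. - w e))"
    by (rule measure_Un_le) auto
  also have "\<dots> \<le> exp (- t\<^sup>2 / (4 * V)) + exp (- t\<^sup>2 / (4 * V))"
    using assms by (intro add_mono bernoulli_sum_tail) auto
  finally show ?thesis by simp
qed

text \<open>Fubini for product measures: a bound that holds for every fixed value of the coordinates
  in \<open>A\<close> survives averaging over them.\<close>

lemma prob_Pi_pmf_le_conditional:
  assumes "finite A" "finite B" "A \<inter> B = {}"
    and "\<And>f. measure_pmf.prob (Pi_pmf B d p) {g. (\<lambda>x. if x \<in> A then f x else g x) \<in> X} \<le> q"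
  shows "measure_pmf.prob (Pi_pmf (A \<union> B) d p) X \<le> q"
proof -
  have q: "q \<ge> 0" using assms(4)[of undefined] measure_nonneg order_trans by blast
  let ?h = "\<lambda>f g x. if x \<in> A then f x else g x"
  have "Pi_pmf (A \<union> B) d p =
      bind_pmf (Pi_pmf A d p) (\<lambda>f. map_pmf (?h f) (Pi_pmf B d p))"
    by (simp add: Pi_pmf_union[OF assms(1-3)] pair_pmf_def map_bind_pmf map_pmf_def
        bind_assoc_pmf bind_return_pmf)
  hence "ennreal (measure_pmf.prob (Pi_pmf (A \<union> B) d p) X) =
      (\<integral>\<^sup>+f. emeasure (map_pmf (?h f) (Pi_pmf B d p)) X \<partial>Pi_pmf A d p)"
    by (simp flip: measure_pmf.emeasure_eq_measure)
  also have "\<dots> \<le> (\<integral>\<^sup>+f. ennreal q \<partial>Pi_pmf A d p)"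
    using assms(4) by (intro nn_integral_mono)
      (auto simp: measure_pmf.emeasure_eq_measure vimage_def intro!: ennreal_leI)
  also have "\<dots> = ennreal q" by simp
  finally show ?thesis using q by simp
qed

section \<open>Deviation of edge counts\<close>

definition edges :: "nat \<Rightarrow> nat set set" where
  "edges m = {e. e \<subseteq> {..<m} \<and> card e = 2}"

definition conn :: "real \<Rightarrow> real \<Rightarrow> nat \<Rightarrow> nat \<Rightarrow> real" where
  "conn \<theta> \<rho> a b = (if a = b then \<theta> else \<rho>)"

definition edge_prob :: "(nat \<Rightarrow> nat) \<Rightarrow> real \<Rightarrow> real \<Rightarrow> nat set \<Rightarrow> real" where
  "edge_prob z \<theta> \<rho> e = (if \<forall>i\<in>e. \<forall>j\<in>e. z i = z j then \<theta> else \<rho>)"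

definition edge_pmf ::
    "nat set set \<Rightarrow> (nat \<Rightarrow> nat) \<Rightarrow> real \<Rightarrow> real \<Rightarrow> (nat set \<Rightarrow> bool) pmf" where
  "edge_pmf E z \<theta> \<rho> = Pi_pmf E False (\<lambda>e. bernoulli_pmf (edge_prob z \<theta> \<rho> e))"

definition nb :: "nat \<Rightarrow> (nat set \<Rightarrow> bool) \<Rightarrow> nat \<Rightarrow> nat set" where
  "nb m x i = {l. l < m \<and> l \<noteq> i \<and> x {i, l}}"

text \<open>The centred number of ordered adjacent pairs in \<open>A \<times> B\<close>. Pairs
  \<open>l = k\<close> are dropped since they carry no random edge; \<open>A\<close> and
  \<open>B\<close> may overlap.\<close>

definition edge_dev ::
    "(nat \<Rightarrow> nat) \<Rightarrow> real \<Rightarrow> real \<Rightarrow> (nat set \<Rightarrow> bool) \<Rightarrow> nat set \<Rightarrow> nat set \<Rightarrow> real" where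
  "edge_dev z \<theta> \<rho> x A B =
     (\<Sum>l\<in>A. \<Sum>k\<in>B. of_bool (l \<noteq> k) * (of_bool (x {l, k}) - conn \<theta> \<rho> (z l) (z k)))"

lemma finite_edges [simp]: "finite (edges m)"
  by (rule finite_subset[of _ "Pow {..<m}"]) (auto simp: edges_def)

lemma pair_in_edges_iff: "{i, j} \<in> edges m \<longleftrightarrow> i < m \<and> j < m \<and> i \<noteq> j"
  by (cases "i = j") (auto simp: edges_def)

lemma edge_prob_pair: "edge_prob z \<theta> \<rho> {i, j} = conn \<theta> \<rho> (z i) (z j)"
  by (auto simp: edge_prob_def conn_def)

lemma finite_nb [simp]: "finite (nb m x i)"
  by (simp add: nb_def)

text \<open>Collecting ordered pairs by their edge rewrites the deviation as a sum of independent
  terms with weights 0, 1 or 2, whose total weight is at most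
  \<open>card A * card B\<close>.\<close>

lemma edge_dev_concentration:
  assumes \<rho>: "0 < \<rho>" "\<rho> \<le> \<theta>" "\<theta> \<le> 1"
    and E: "finite E" and A: "finite A" and B: "finite B"
    and AB: "\<And>l k. l \<in> A \<Longrightarrow> k \<in> B \<Longrightarrow> l \<noteq> k \<Longrightarrow> {l, k} \<in> E"
    and V: "2 * real (card A) * real (card B) * \<theta> \<le> V" "0 < V" and t: "0 \<le> t" "t \<le> V"
  shows "measure_pmf.prob (edge_pmf E z \<theta> \<rho>) {x. t \<le> \<bar>edge_dev z \<theta> \<rho> x A B\<bar>}
           \<le> 2 * exp (- t\<^sup>2 / (4 * V))"
proof -
  define S where "S = {(l, k) \<in> A \<times> B. l \<noteq> k}"
  define h where "h = (\<lambda>(l, k). {l, k :: nat})"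
  \<comment> \<open>The number of ordered pairs that give the edge \<open>e\<close>: two when both
    orientations lie in \<open>A \<times> B\<close>.\<close>
  define w where "w = (\<lambda>e. real (card {y \<in> S. h y = e}))"
  have finS: "finite S" using A B by (auto simp: S_def intro: finite_subset[of _ "A \<times> B"])
  have hS: "h ` S \<subseteq> E" using AB by (auto simp: S_def h_def)
  have group: "(\<Sum>(l, k)\<in>S. g {l, k}) = (\<Sum>e\<in>E. w e * g e)" for g :: "nat set \<Rightarrow> real"
  proof -
    have "(\<Sum>(l, k)\<in>S. g {l, k}) = (\<Sum>y\<in>S. g (h y))"
      by (simp add: h_def case_prod_unfold)
    also have "\<dots> = (\<Sum>e\<in>E. \<Sum>y\<in>{y \<in> S. h y = e}. g (h y))"
      by (rule sum.group[OF finS E hS, symmetric])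
    also have "\<dots> = (\<Sum>e\<in>E. w e * g e)"
      by (intro sum.cong refl) (simp add: w_def)
    finally show ?thesis .
  qed
  have w2: "w e \<le> 2" for e
  proof (cases "{y \<in> S. h y = e} = {}")
    case False
    then obtain a b where e: "e = {a, b}" by (auto simp: h_def)
    have "{y \<in> S. h y = e} \<subseteq> {(a, b), (b, a)}"
    proof
      fix y assume "y \<in> {y \<in> S. h y = e}"
      hence "{fst y, snd y} = {a, b}" by (simp add: h_def e case_prod_unfold)
      thus "y \<in> {(a, b), (b, a)}" by (cases y) (auto simp: doubleton_eq_iff)
    qed
    hence "card {y \<in> S. h y = e} \<le> card {(a, b), (b, a)}"
      by (rule card_mono[rotated]) simp
    also have "\<dots> \<le> 2" using card_insert_le_m1[of 2 "{(b, a)}" "(a, b)"] by simp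
    finally show ?thesis by (simp add: w_def)
  next
    case True
    show ?thesis by (simp only: w_def True) simp
  qed
  have p: "0 \<le> edge_prob z \<theta> \<rho> e" "edge_prob z \<theta> \<rho> e \<le> \<theta>" for e
    using \<rho> by (auto simp: edge_prob_def)
  \<comment> \<open>One factor \<open>w e\<close> is bounded by 2 and the other kept, because the
    sum of the \<open>w e\<close> is just \<open>card S\<close>.\<close>
  have "(\<Sum>e\<in>E. (w e)\<^sup>2 * edge_prob z \<theta> \<rho> e) \<le> (\<Sum>e\<in>E. w e * (2 * \<theta>))"
  proof (rule sum_mono)
    fix e
    have "(w e)\<^sup>2 * edge_prob z \<theta> \<rho> e = w e * (w e * edge_prob z \<theta> \<rho> e)"
      by (simp add: power2_eq_square)
    also have "\<dots> \<le> w e * (2 * \<theta>)"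
      using w2[of e] p[of e] by (intro mult_left_mono mult_mono) (auto simp: w_def)
    finally show "(w e)\<^sup>2 * edge_prob z \<theta> \<rho> e \<le> w e * (2 * \<theta>)" .
  qed
  also have "\<dots> = real (card S) * (2 * \<theta>)"
    using group[of "\<lambda>_. 2 * \<theta>"] by simp
  also have "\<dots> \<le> real (card (A \<times> B)) * (2 * \<theta>)"
    using \<rho> A B by (intro mult_right_mono of_nat_mono card_mono) (auto simp: S_def)
  also have "\<dots> \<le> V" using V by (simp add: card_cartesian_product mult_ac)
  finally have var: "(\<Sum>e\<in>E. (w e)\<^sup>2 * edge_prob z \<theta> \<rho> e) \<le> V" .
  have "edge_dev z \<theta> \<rho> x A B = (\<Sum>e\<in>E. w e * (of_bool (x e) - edge_prob z \<theta> \<rho> e))" for x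
  proof -
    have "edge_dev z \<theta> \<rho> x A B =
        (\<Sum>(l, k)\<in>A \<times> B. of_bool (l \<noteq> k) * (of_bool (x {l, k}) - conn \<theta> \<rho> (z l) (z k)))"
      by (simp add: edge_dev_def sum.cartesian_product)
    also have "\<dots> = (\<Sum>(l, k)\<in>S. of_bool (x {l, k}) - edge_prob z \<theta> \<rho> {l, k})"
      using A B by (intro sum.mono_neutral_cong_right) (auto simp: S_def edge_prob_pair)
    also have "\<dots> = (\<Sum>e\<in>E. w e * (of_bool (x e) - edge_prob z \<theta> \<rho> e))"
      by (rule group)
    finally show ?thesis .
  qed
  moreover have "measure_pmf.prob (edge_pmf E z \<theta> \<rho>)
      {x. t \<le> \<bar>\<Sum>e\<in>E. w e * (of_bool (x e) - edge_prob z \<theta> \<rho> e)\<bar>} \<le> 2 * exp (- t\<^sup>2 / (4 * V))"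
    unfolding edge_pmf_def
  proof (rule bernoulli_sum_concentration[OF E _ _ var V(2) t])
    show "0 \<le> edge_prob z \<theta> \<rho> e \<and> edge_prob z \<theta> \<rho> e \<le> 1" for e
      using p[of e] \<rho> by linarith
    show "\<bar>w e\<bar> \<le> 2" for e using w2[of e] by (simp add: w_def)
  qed
  ultimately show ?thesis by simp
qed

text \<open>Given the rows \<open>i\<close> and \<open>j\<close> of the adjacency matrix, the edges between the two
  neighbourhoods that avoid \<open>i\<close> and \<open>j\<close> are still independent.\<close>

lemma nb_dev_concentration:
  assumes \<rho>: "0 < \<rho>" "\<rho> \<le> \<theta>" "\<theta> \<le> 1" and ij: "i < m" "j < m"
    and U: "0 < U" and t: "0 \<le> t" "t \<le> 2 * U\<^sup>2 * \<theta>"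
  shows "measure_pmf.prob (edge_pmf (edges m) z \<theta> \<rho>)
           {x. real (card (nb m x i)) \<le> U \<and> real (card (nb m x j)) \<le> U \<and>
               t \<le> \<bar>edge_dev z \<theta> \<rho> x (nb m x i - {j}) (nb m x j - {i})\<bar>}
         \<le> 2 * exp (- t\<^sup>2 / (8 * U\<^sup>2 * \<theta>))" (is "measure_pmf.prob _ ?X \<le> _")
proof -
  \<comment> \<open>The edges in \<open>E1\<close> determine both neighbourhoods; those in
    \<open>E2\<close> are the ones counted between them. The former are frozen and the bound is
    applied to the latter.\<close>
  define E1 where "E1 = {e \<in> edges m. i \<in> e \<or> j \<in> e}"
  define E2 where "E2 = {e \<in> edges m. i \<notin> e \<and> j \<notin> e}"
  have E: "edges m = E1 \<union> E2" "E1 \<inter> E2 = {}" "finite E1" "finite E2"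
    by (auto simp: E1_def E2_def)
  define h where "h = (\<lambda>f g e. if e \<in> E1 then f e else g e :: bool)"
  have nb_h: "nb m (h f g) v = nb m f v" if "v = i \<or> v = j" for f g v
    using that ij by (auto simp: nb_def h_def E1_def pair_in_edges_iff)
  have "measure_pmf.prob (edge_pmf E2 z \<theta> \<rho>) {g. h f g \<in> ?X} \<le> 2 * exp (- t\<^sup>2 / (8 * U\<^sup>2 * \<theta>))" for f
  \<comment> \<open>The size restriction depends on \<open>f\<close> only. If \<open>f\<close>
    violates it, the event is empty; otherwise \<open>A\<close> and \<open>B\<close> are fixed sets
    of bounded size.\<close>
  proof (cases "real (card (nb m f i)) \<le> U \<and> real (card (nb m f j)) \<le> U")
    case nbU: True
    define A where "A = nb m f i - {j}"
    define B where "B = nb m f j - {i}"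
    \<comment> \<open>Neither \<open>A\<close> nor \<open>B\<close> contains \<open>i\<close> or
      \<open>j\<close>, so no frozen edge is counted.\<close>
    have "edge_dev z \<theta> \<rho> (h f g) A B = edge_dev z \<theta> \<rho> g A B" for g
      unfolding edge_dev_def
      by (intro sum.cong refl) (auto simp: A_def B_def nb_def h_def E1_def)
    hence "{g. h f g \<in> ?X} \<subseteq> {g. t \<le> \<bar>edge_dev z \<theta> \<rho> g A B\<bar>}"
      by (auto simp: nb_h A_def B_def)
    hence "measure_pmf.prob (edge_pmf E2 z \<theta> \<rho>) {g. h f g \<in> ?X}
        \<le> measure_pmf.prob (edge_pmf E2 z \<theta> \<rho>) {g. t \<le> \<bar>edge_dev z \<theta> \<rho> g A B\<bar>}"
      by (intro measure_pmf.finite_measure_mono) auto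
    also have "\<dots> \<le> 2 * exp (- t\<^sup>2 / (4 * (2 * U\<^sup>2 * \<theta>)))"
    proof (rule edge_dev_concentration)
      show "{l, k} \<in> E2" if "l \<in> A" "k \<in> B" "l \<noteq> k" for l k
        using that by (auto simp: A_def B_def nb_def E2_def pair_in_edges_iff)
      have "card A \<le> card (nb m f i)" "card B \<le> card (nb m f j)"
        by (auto simp: A_def B_def intro: card_mono)
      hence "real (card A) \<le> U" "real (card B) \<le> U" using nbU by linarith+
      hence "real (card A) * real (card B) \<le> U * U" using U by (intro mult_mono) auto
      hence "real (card A) * real (card B) * (2 * \<theta>) \<le> U * U * (2 * \<theta>)"
        using \<rho> by (intro mult_right_mono) auto
      thus "2 * real (card A) * real (card B) * \<theta> \<le> 2 * U\<^sup>2 * \<theta>"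
        by (simp add: power2_eq_square mult_ac)
    qed (use \<rho> U t E(4) in \<open>auto simp: A_def B_def\<close>)
    finally show ?thesis by (simp add: mult_ac)
  next
    case False
    hence empty: "{g. h f g \<in> ?X} = {}"
      by (auto simp: nb_h)
    show ?thesis unfolding empty by simp
  qed
  note cond = this
  have "measure_pmf.prob (Pi_pmf (E1 \<union> E2) False (\<lambda>e. bernoulli_pmf (edge_prob z \<theta> \<rho> e))) ?X
      \<le> 2 * exp (- t\<^sup>2 / (8 * U\<^sup>2 * \<theta>))"
  proof (rule prob_Pi_pmf_le_conditional[OF E(3,4,2)])
    fix f
    show "measure_pmf.prob (Pi_pmf E2 False (\<lambda>e. bernoulli_pmf (edge_prob z \<theta> \<rho> e)))
        {g. (\<lambda>e. if e \<in> E1 then f e else g e) \<in> ?X} \<le> 2 * exp (- t\<^sup>2 / (8 * U\<^sup>2 * \<theta>))"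
      using cond[of f] unfolding h_def edge_pmf_def .
  qed
  thus ?thesis by (simp only: edge_pmf_def E(1))
qed

section \<open>Accuracy of the estimators\<close>

text \<open>The pooled estimator is the mean of the three others with weights \<open>N i i\<close>,
  \<open>2 * N i j\<close> and \<open>N j j\<close>.\<close>

lemma theta_join_bounds:
  assumes pos: "0 < Ncount m Y i i" "0 < Ncount m Y j j" "0 < Ncount m Y i j"
    and est: "\<And>a b. (a, b) \<in> {(i, i), (j, j), (i, j)} \<Longrightarrow>
                u \<le> theta_est m Y S a b \<and> theta_est m Y S a b \<le> v"
  shows "u \<le> theta_join m Y S i j" "theta_join m Y S i j \<le> v"
proof -
  let ?N = "Ncount m Y"
  define M where "M = ?N i i + 2 * ?N i j + ?N j j"
  have M: "M > 0" using pos by (simp add: M_def)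
  have S: "u * ?N a b \<le> S a b \<and> S a b \<le> v * ?N a b" if "(a, b) \<in> {(i, i), (j, j), (i, j)}" for a b
    using est[OF that] pos that by (auto simp: theta_est_def divide_simps)
  note SS = S[of i i] S[of j j] S[of i j]
  have "u * M \<le> S i i + 2 * S i j + S j j" "S i i + 2 * S i j + S j j \<le> v * M"
    using SS by (simp_all add: M_def algebra_simps)
  thus "u \<le> theta_join m Y S i j" "theta_join m Y S i j \<le> v"
    using M by (simp_all add: theta_join_def M_def[symmetric] divide_simps mult.commute)
qed

section \<open>From accurate estimators to the size of the test statistic\<close>

text \<open>The pooled estimator is also within \<open>g\<close> of \<open>p\<close>, so each
  divergence compares values at most \<open>2 * g\<close> apart and the chi-square bound applies to
  each of the three terms.\<close>

lemma T_stat_le: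
  assumes N: "\<And>a b. (a, b) \<in> {(i, i), (j, j), (i, j)} \<Longrightarrow> 0 < Ncount m Y a b \<and> Ncount m Y a b \<le> h"
    and est: "\<And>a b. (a, b) \<in> {(i, i), (j, j), (i, j)} \<Longrightarrow> \<bar>theta_est m Y S a b - p\<bar> \<le> g"
    and q: "0 < q" "q \<le> p - g" "p + g \<le> 3 / 4"
  shows "T_stat m Y S i j \<le> 48 * h * g\<^sup>2 / q"
proof -
  let ?N = "Ncount m Y" and ?t = "theta_join m Y S i j" and ?I = "{(i, i), (j, j), (i, j)}"
  have est': "p - g \<le> theta_est m Y S a b \<and> theta_est m Y S a b \<le> p + g" if "(a, b) \<in> ?I" for a b
    using est[OF that] by linarith
  have t: "p - g \<le> ?t" "?t \<le> p + g"
    using theta_join_bounds[of m Y i j "p - g" S "p + g"] N est' by auto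
  have KL: "?N a b * KL_bernoulli (theta_est m Y S a b) ?t \<le> 16 * h * g\<^sup>2 / q" if I: "(a, b) \<in> ?I" for a b
  proof -
    have "KL_bernoulli (theta_est m Y S a b) ?t \<le> (theta_est m Y S a b - ?t)\<^sup>2 / (?t * (1 - ?t))"
      using est'[OF I] t q by (intro KL_bernoulli_le) linarith+
    also have "\<dots> \<le> (2 * g)\<^sup>2 / (q * (1 / 4))"
    proof (rule frac_le)
      show "(theta_est m Y S a b - ?t)\<^sup>2 \<le> (2 * g)\<^sup>2"
        using est'[OF I] t by (intro power2_le_iff_abs_le[THEN iffD2]) linarith+
      show "q * (1 / 4) \<le> ?t * (1 - ?t)" using t q by (intro mult_mono) linarith+
    qed (use q in auto)
    also have "\<dots> = 16 * g\<^sup>2 / q" using q by (simp add: power_mult_distrib)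
    finally have "?N a b * KL_bernoulli (theta_est m Y S a b) ?t \<le> ?N a b * (16 * g\<^sup>2 / q)"
      using N[OF I] by (intro mult_left_mono) auto
    also have "\<dots> \<le> h * (16 * g\<^sup>2 / q)"
      using N[OF I] q by (intro mult_right_mono) auto
    finally show ?thesis by (simp add: mult_ac)
  qed
  have "h > 0" using N[of i i] by auto
  \<comment> \<open>Covers the default value 0 of an undefined statistic.\<close>
  hence "0 \<le> 48 * h * g\<^sup>2 / q" using q by simp
  moreover have "16 * h * g\<^sup>2 / q + 16 * h * g\<^sup>2 / q + 16 * h * g\<^sup>2 / q = 48 * h * g\<^sup>2 / q"
    by simp
  ultimately show ?thesis
    using KL[of i i] KL[of j j] KL[of i j] by (simp add: T_stat_def del: times_divide_eq_left)
qed

text \<open>One of the two separated estimators is at least \<open>\<Delta> / 2\<close> away from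
  the pooled one; that single term already gives the bound, the others being nonnegative. The range
  \<open>u\<close> to \<open>v\<close> inside the open unit interval rules out the default value 0,
  which would be useless here.\<close>

lemma T_stat_ge:
  assumes N: "\<And>a b. (a, b) \<in> {(i, i), (j, j), (i, j)} \<Longrightarrow> h \<le> Ncount m Y a b" and h: "0 < h"
    and est: "\<And>a b. (a, b) \<in> {(i, i), (j, j), (i, j)} \<Longrightarrow>
                u \<le> theta_est m Y S a b \<and> theta_est m Y S a b \<le> v"
    and uv: "0 < u" "v < 1"
    and gap: "\<Delta> \<le> \<bar>theta_est m Y S i i - theta_est m Y S i j\<bar>" "0 \<le> \<Delta>"
  shows "h * \<Delta>\<^sup>2 / (16 * v) \<le> T_stat m Y S i j"
proof -
  let ?N = "Ncount m Y" and ?t = "theta_join m Y S i j" and ?I = "{(i, i), (j, j), (i, j)}"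
  have Npos: "0 < ?N a b" if "(a, b) \<in> ?I" for a b using N[OF that] h by linarith
  note ests = est[of i i] est[of j j] est[of i j]
  have t: "u \<le> ?t" "?t \<le> v"
    using theta_join_bounds[of m Y i j u S v] Npos est by auto
  have v: "0 < v" using t uv by linarith
  have KL: "h * (theta_est m Y S a b - ?t)\<^sup>2 / (4 * v) \<le> ?N a b * KL_bernoulli (theta_est m Y S a b) ?t"
    if I: "(a, b) \<in> ?I" for a b
  proof -
    have "h * ((theta_est m Y S a b - ?t)\<^sup>2 / (4 * v)) \<le> ?N a b * KL_bernoulli (theta_est m Y S a b) ?t"
    proof (rule mult_mono)
      show "(theta_est m Y S a b - ?t)\<^sup>2 / (4 * v) \<le> KL_bernoulli (theta_est m Y S a b) ?t"
        using est[OF I] t uv by (intro KL_bernoulli_ge) linarith+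
    qed (use N[OF I] Npos[OF I] v in auto)
    thus ?thesis by simp
  qed
  have KL0: "0 \<le> ?N a b * KL_bernoulli (theta_est m Y S a b) ?t" if I: "(a, b) \<in> ?I" for a b
    using KL[OF I] h v by (intro order_trans[OF _ KL[OF I]]) auto
  have sum_pos: "?N i i + 2 * ?N i j + ?N j j \<noteq> 0"
    using Npos[of i i] Npos[of i j] Npos[of j j] by auto
  have "T_defined m Y S i j"
    using Npos[of i i] Npos[of i j] Npos[of j j] ests t uv sum_pos
    by (auto simp: T_defined_def)
  hence T: "T_stat m Y S i j = ?N i i * KL_bernoulli (theta_est m Y S i i) ?t +
        ?N j j * KL_bernoulli (theta_est m Y S j j) ?t + ?N i j * KL_bernoulli (theta_est m Y S i j) ?t"
    by (simp add: T_stat_def)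
  obtain a b where ab: "(a, b) \<in> {(i, i), (i, j)}" "\<Delta> / 2 \<le> \<bar>theta_est m Y S a b - ?t\<bar>"
  proof (cases "\<Delta> / 2 \<le> \<bar>theta_est m Y S i i - ?t\<bar>")
    case False
    with gap have "\<Delta> / 2 \<le> \<bar>theta_est m Y S i j - ?t\<bar>" by linarith
    thus ?thesis using that[of i j] by simp
  qed (use that[of i i] in simp)
  have "(\<Delta> / 2)\<^sup>2 \<le> (theta_est m Y S a b - ?t)\<^sup>2"
    using ab gap by (metis abs_of_nonneg divide_nonneg_nonneg abs_le_square_iff zero_le_numeral)
  hence "h * (\<Delta> / 2)\<^sup>2 / (4 * v) \<le> h * (theta_est m Y S a b - ?t)\<^sup>2 / (4 * v)"
    using h v by (intro divide_right_mono mult_left_mono) auto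
  also have "\<dots> \<le> ?N a b * KL_bernoulli (theta_est m Y S a b) ?t"
    using ab by (intro KL) auto
  also have "\<dots> \<le> T_stat m Y S i j"
    using KL0[of i i] KL0[of j j] KL0[of i j] ab by (auto simp: T)
  also have "h * (\<Delta> / 2)\<^sup>2 / (4 * v) = h * \<Delta>\<^sup>2 / (16 * v)"
    by (simp add: power_divide)
  finally show ?thesis .
qed

text \<open>Since \<open>e \<le> M\<close>, the perturbed factor \<open>b\<close> is at most
  \<open>2 * M\<close> in absolute value, and the two replacements cost \<open>2 * e * M\<close> and
  \<open>e * M\<close>.\<close>

lemma abs_mult_diff_le:
  fixes a b a' b' e M :: real
  assumes "\<bar>a - a'\<bar> \<le> e" "\<bar>b - b'\<bar> \<le> e" "0 \<le> a'" "a' \<le> M" "0 \<le> b'" "b' \<le> M" "e \<le> M"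
  shows "\<bar>a * b - a' * b'\<bar> \<le> 3 * e * M"
proof -
  have e: "0 \<le> e" using assms(1) by linarith
  have "a * b - a' * b' = (a - a') * b + a' * (b - b')" by (simp add: algebra_simps)
  also have "\<bar>\<dots>\<bar> \<le> \<bar>a - a'\<bar> * \<bar>b\<bar> + \<bar>a'\<bar> * \<bar>b - b'\<bar>"
    by (metis abs_triangle_ineq abs_mult)
  also have "\<dots> \<le> e * (2 * M) + M * e"
    using assms e by (intro add_mono mult_mono) linarith+
  finally show ?thesis by (simp add: mult_ac)
qed

section \<open>Limiting densities and graphs with typical neighbourhoods\<close>

definition adj :: "(nat set \<Rightarrow> bool) \<Rightarrow> nat \<Rightarrow> nat \<Rightarrow> real" where
  "adj x i j = of_bool (x {i, j})"

text \<open>The average of \<open>conn\<close> over a neighbour of \<open>i\<close> and a neighbour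
  of \<open>j\<close> when the neighbourhoods have their ideal community compositions;
  \<open>b\<close> says whether \<open>i\<close> and \<open>j\<close> share a community. The
  fraction, without the factor \<open>\<theta> - \<rho>\<close>, is the probability that the two
  neighbours do.\<close>

definition pair_density :: "nat \<Rightarrow> real \<Rightarrow> real \<Rightarrow> bool \<Rightarrow> real" where
  "pair_density K \<theta> \<rho> b =
     \<rho> + (\<theta> - \<rho>) * (real K * \<rho>\<^sup>2 + 2 * \<rho> * (\<theta> - \<rho>) + (\<theta> - \<rho>)\<^sup>2 * of_bool b) /
         (real K * \<rho> + (\<theta> - \<rho>))\<^sup>2"

text \<open>The difference of the two values of \<open>pair_density\<close>; see
  \<open>pair_density_gap\<close>.\<close>

definition density_gap :: "nat \<Rightarrow> real \<Rightarrow> real \<Rightarrow> real" where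
  "density_gap K \<theta> \<rho> = (\<theta> - \<rho>) ^ 3 / (real K * \<rho> + (\<theta> - \<rho>))\<^sup>2"

text \<open>The noise level \<open>\<eta>\<close> will be a small multiple of the density gap.\<close>

locale sbm_rows =
  fixes n K :: nat and \<theta> \<rho> \<eta> :: real and z :: "nat \<Rightarrow> nat" and x :: "nat set \<Rightarrow> bool"
  assumes bal: "balanced_communities n K z" and K: "K \<ge> 1" and n: "n \<ge> 1"
    and params: "0 < \<rho>" "\<rho> < \<theta>" "\<theta> \<le> 1 / 2"
    and no_loops: "\<And>i. \<not> x {i}"
    and \<eta>: "0 < \<eta>" "6 * (real K)\<^sup>2 * \<eta> \<le> \<theta>" "2 * real K \<le> \<eta> * real n"
    and rows: "\<And>i a. i < n * K \<Longrightarrow> a < K \<Longrightarrow>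
      \<bar>real (card {l \<in> nb (n * K) x i. z l = a}) - real n * conn \<theta> \<rho> (z i) a\<bar> \<le> \<eta> * real n / 2"
begin

abbreviation "m \<equiv> n * K"
abbreviation "Y \<equiv> adj x"
abbreviation "V i \<equiv> nb m x i"
text \<open>Equal to \<open>\<theta> + (K - 1) * \<rho>\<close>, the row sum of \<open>conn\<close>;
  the ideal neighbourhood size is \<open>n * s\<close>.\<close>

definition "s = real K * \<rho> + (\<theta> - \<rho>)"

lemma K_pos: "real K \<ge> 1" using K by simp

lemma n_pos: "real n \<ge> 1" using n by simp

lemma s_bounds: "\<theta> \<le> s" "s \<le> real K * \<theta>"
proof -
  have "1 * \<rho> \<le> real K * \<rho>" using K_pos params by (intro mult_right_mono) auto
  thus "\<theta> \<le> s" by (simp add: s_def)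
  have "1 * (\<theta> - \<rho>) \<le> real K * (\<theta> - \<rho>)" using K_pos params by (intro mult_right_mono) auto
  thus "s \<le> real K * \<theta>" by (simp add: s_def algebra_simps)
qed

lemma z_less: "i < m \<Longrightarrow> z i < K"
  using bal by (auto simp: balanced_communities_def)

lemma eta_le: "real K * \<eta> \<le> \<theta>" "\<eta> \<le> \<theta>"
proof -
  have "real K * \<eta> \<le> 6 * (real K)\<^sup>2 * \<eta>"
    using K_pos \<eta>(1) by (intro mult_right_mono) (auto simp: power2_eq_square)
  with \<eta>(2) show *: "real K * \<eta> \<le> \<theta>" by linarith
  have "1 * \<eta> \<le> real K * \<eta>" using K_pos \<eta>(1) by (intro mult_right_mono) auto
  with * show "\<eta> \<le> \<theta>" by linarith
qed

lemma nbhd_adj: "nbhd m Y i = V i"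
  using no_loops by (auto simp: nbhd_def nb_def adj_def)

lemma sum_conn: "(\<Sum>a<K. conn \<theta> \<rho> b a) = s" if "b < K"
proof -
  have "(\<Sum>a<K. conn \<theta> \<rho> b a) = (\<Sum>a<K. \<rho> + (if a = b then \<theta> - \<rho> else 0))"
    by (intro sum.cong) (auto simp: conn_def)
  also have "\<dots> = s" using that by (simp add: sum.distrib s_def)
  finally show ?thesis .
qed

text \<open>Expand \<open>conn\<close> as \<open>\<rho>\<close> plus
  \<open>\<theta> - \<rho>\<close> times an equality indicator. Only the product of the two
  indicators sees whether the communities agree, and this is the source of the whole signal.\<close>

lemma sum_conn_mult:
  assumes "b < K" "c < K"
  shows "(\<Sum>a<K. conn \<theta> \<rho> b a * conn \<theta> \<rho> c a) =
         real K * \<rho>\<^sup>2 + 2 * \<rho> * (\<theta> - \<rho>) + (\<theta> - \<rho>)\<^sup>2 * of_bool (b = c)"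
proof -
  have "(\<Sum>a<K. conn \<theta> \<rho> b a * conn \<theta> \<rho> c a) =
      (\<Sum>a<K. \<rho>\<^sup>2 + (if a = b then \<rho> * (\<theta> - \<rho>) else 0) + (if a = c then \<rho> * (\<theta> - \<rho>) else 0) +
        (if a = b then (\<theta> - \<rho>)\<^sup>2 * of_bool (b = c) else 0))"
    by (intro sum.cong refl) (auto simp: conn_def algebra_simps power2_eq_square)
  also have "\<dots> = real K * \<rho>\<^sup>2 + 2 * \<rho> * (\<theta> - \<rho>) + (\<theta> - \<rho>)\<^sup>2 * of_bool (b = c)"
    using assms by (simp add: sum.distrib)
  finally show ?thesis .
qed

lemma card_by_class:
  assumes "A \<subseteq> {..<m}"
  shows "real (card A) = (\<Sum>a<K. real (card {l \<in> A. z l = a}))"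
proof -
  have "finite A" using assms finite_subset by blast
  have "(\<Sum>l\<in>A. 1) = (\<Sum>a<K. \<Sum>l\<in>{l \<in> A. z l = a}. (1::real))"
    using assms z_less by (intro sum.group[symmetric] \<open>finite A\<close>) auto
  thus ?thesis by simp
qed

text \<open>Because \<open>conn\<close> takes one value within and one value across communities, the
  sum depends only on the community counts of \<open>A\<close> and \<open>B\<close>.\<close>

lemma sum_conn_pairs:
  assumes "A \<subseteq> {..<m}" "B \<subseteq> {..<m}"
  shows "(\<Sum>l\<in>A. \<Sum>k\<in>B. conn \<theta> \<rho> (z l) (z k)) = \<rho> * (real (card A) * real (card B)) +
    (\<theta> - \<rho>) * (\<Sum>a<K. real (card {l \<in> A. z l = a}) * real (card {k \<in> B. z k = a}))"
proof -
  have fin: "finite A" "finite B" using assms finite_subset by blast+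
  have "(\<Sum>l\<in>A. \<Sum>k\<in>B. conn \<theta> \<rho> (z l) (z k)) =
      (\<Sum>l\<in>A. \<Sum>k\<in>B. \<rho> + (\<theta> - \<rho>) * of_bool (z k = z l))"
    by (intro sum.cong refl) (auto simp: conn_def)
  also have "\<dots> = \<rho> * (real (card A) * real (card B)) +
      (\<theta> - \<rho>) * (\<Sum>l\<in>A. real (card {k \<in> B. z k = z l}))"
    using fin by (simp add: sum.distrib sum_distrib_left Int_def mult.commute)
  also have "(\<Sum>l\<in>A. real (card {k \<in> B. z k = z l})) =
      (\<Sum>a<K. \<Sum>l\<in>{l \<in> A. z l = a}. real (card {k \<in> B. z k = z l}))"
    using assms z_less fin by (intro sum.group[symmetric]) auto
  also have "\<dots> = (\<Sum>a<K. real (card {l \<in> A. z l = a}) * real (card {k \<in> B. z k = a}))"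
    by (intro sum.cong refl) simp
  finally show ?thesis .
qed


lemma conn_nonneg: "0 \<le> conn \<theta> \<rho> a b" and conn_le: "conn \<theta> \<rho> a b \<le> \<theta>"
  using params by (auto simp: conn_def)

text \<open>The row assumption uses only half of \<open>\<eta> * n\<close>. The other half is at
  least 1 and absorbs the possible removal of \<open>j\<close>.\<close>

lemma class_count:
  assumes "i < m" "a < K"
  shows "\<bar>real (card {l \<in> V i - {j}. z l = a}) - real n * conn \<theta> \<rho> (z i) a\<bar> \<le> \<eta> * real n"
proof -
  have "2 \<le> \<eta> * real n" using \<eta>(3) K_pos by linarith
  moreover have "real (card {l \<in> V i. z l = a}) - 1 \<le> real (card {l \<in> V i - {j}. z l = a})"
  proof -
    have "{l \<in> V i - {j}. z l = a} = {l \<in> V i. z l = a} - {j}" by auto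
    thus ?thesis using diff_card_le_card_Diff[of "{j}" "{l \<in> V i. z l = a}"] by simp
  qed
  moreover have "card {l \<in> V i - {j}. z l = a} \<le> card {l \<in> V i. z l = a}"
    by (intro card_mono) auto
  ultimately show ?thesis using rows[OF assms] by linarith
qed

lemma card_nb_Diff: "\<bar>real (card (V i - {j})) - real n * s\<bar> \<le> real K * (\<eta> * real n)" if "i < m"
proof -
  have "V i - {j} \<subseteq> {..<m}" by (auto simp: nb_def)
  hence "real (card (V i - {j})) - real n * s =
      (\<Sum>a<K. real (card {l \<in> V i - {j}. z l = a}) - real n * conn \<theta> \<rho> (z i) a)"
    using sum_conn[OF z_less[OF that]]
    by (simp add: card_by_class sum_subtractf flip: sum_distrib_left)
  also have "\<bar>\<dots>\<bar> \<le> (\<Sum>a<K. \<eta> * real n)"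
    by (rule order_trans[OF sum_abs]) (use class_count[OF that] in \<open>intro sum_mono, auto\<close>)
  finally show ?thesis by simp
qed

text \<open>The whole neighbourhood keeps the halved error, which leaves room for the diagonal
  correction \<open>- 1\<close> in \<open>Ncount\<close>.\<close>

lemma card_nb: "\<bar>real (card (V i)) - real n * s\<bar> \<le> real K * (\<eta> * real n) / 2" if "i < m"
proof -
  have "V i \<subseteq> {..<m}" by (auto simp: nb_def)
  hence "real (card (V i)) - real n * s =
      (\<Sum>a<K. real (card {l \<in> V i. z l = a}) - real n * conn \<theta> \<rho> (z i) a)"
    using sum_conn[OF z_less[OF that]]
    by (simp add: card_by_class sum_subtractf flip: sum_distrib_left)
  also have "\<bar>\<dots>\<bar> \<le> (\<Sum>a<K. \<eta> * real n / 2)"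
    by (rule order_trans[OF sum_abs]) (use rows[OF that] in \<open>intro sum_mono, auto\<close>)
  finally show ?thesis by simp
qed

text \<open>This crude bound is the truncation level \<open>U\<close> in the conditional
  concentration argument.\<close>

lemma card_nb_le: "real (card (V i)) \<le> 2 * (real K * (real n * \<theta>))" if "i < m"
proof -
  have "real n * s \<le> real n * (real K * \<theta>)" using s_bounds by (intro mult_left_mono) auto
  hence "real n * s \<le> real K * (real n * \<theta>)" by (simp add: mult_ac)
  moreover have "real K * (\<eta> * real n) \<le> real K * (\<theta> * real n)"
    using eta_le(2) by (intro mult_left_mono mult_right_mono) auto
  hence "real K * (\<eta> * real n) \<le> real K * (real n * \<theta>)" by (simp add: mult_ac)
  moreover have "0 \<le> real K * (\<eta> * real n)" using \<eta> by simp
  ultimately show ?thesis using card_nb[OF that] by linarith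
qed

lemma Ncount_approx:
  assumes "i < m" "j < m"
  shows "\<bar>Ncount m Y i j - (real n * s)\<^sup>2\<bar> \<le> 3 * (real K)\<^sup>2 * \<eta> * \<theta> * (real n)\<^sup>2"
proof -
  define e where "e = real K * (\<eta> * real n)"
  have "2 * real K * 1 \<le> \<eta> * real n * real K"
    using \<eta> by (intro mult_mono[OF \<eta>(3) K_pos]) auto
  moreover have "\<eta> * real n * real K = e" by (simp add: e_def mult_ac)
  ultimately have e2: "2 \<le> e" using K_pos by linarith
  have b: "real n * s \<le> real n * (real K * \<theta>)" "e \<le> real n * (real K * \<theta>)" "0 \<le> real n * s"
  proof -
    show "real n * s \<le> real n * (real K * \<theta>)" using s_bounds by (intro mult_left_mono) auto
    have "real K * \<eta> \<le> real K * \<theta>" using eta_le(2) by (intro mult_left_mono) auto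
    hence "real n * (real K * \<eta>) \<le> real n * (real K * \<theta>)" by (rule mult_left_mono) simp
    thus "e \<le> real n * (real K * \<theta>)" by (simp add: e_def mult_ac)
    show "0 \<le> real n * s" using s_bounds params by simp
  qed
  have "\<bar>real (card (V i)) * (real (card (V j)) - of_bool (i = j)) - real n * s * (real n * s)\<bar>
      \<le> 3 * e * (real n * (real K * \<theta>))"
  proof (rule abs_mult_diff_le)
    show "\<bar>real (card (V i)) - real n * s\<bar> \<le> e"
      using card_nb[OF assms(1), folded e_def] e2 by linarith
    have "0 \<le> (of_bool (i = j) :: real)" "(of_bool (i = j) :: real) \<le> 1" by simp_all
    thus "\<bar>real (card (V j)) - of_bool (i = j) - real n * s\<bar> \<le> e"
      using card_nb[OF assms(2), folded e_def] e2 by linarith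
  qed (use b in auto)
  moreover have "Ncount m Y i j = real (card (V i)) * (real (card (V j)) - of_bool (i = j))"
    by (simp only: Ncount_def nbhd_adj)
  moreover have "3 * e * (real n * (real K * \<theta>)) = 3 * (real K)\<^sup>2 * \<eta> * \<theta> * (real n)\<^sup>2"
    by (simp add: e_def power2_eq_square)
  ultimately show ?thesis by (simp only: power2_eq_square[of "real n * s"])
qed

text \<open>The assumption \<open>6 * K^2 * \<eta> \<le> \<theta>\<close> makes the error in
  \<open>Ncount_approx\<close> at most \<open>(n * \<theta>)^2 / 2\<close>.\<close>

lemma Ncount_bounds:
  assumes "i < m" "j < m"
  shows "(real n * \<theta>)\<^sup>2 / 2 \<le> Ncount m Y i j" "Ncount m Y i j \<le> 2 * (real K)\<^sup>2 * (real n * \<theta>)\<^sup>2"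
proof -
  have "3 * (real K)\<^sup>2 * \<eta> \<le> \<theta> / 2" using \<eta> by simp
  hence "3 * (real K)\<^sup>2 * \<eta> * (\<theta> * (real n)\<^sup>2) \<le> \<theta> / 2 * (\<theta> * (real n)\<^sup>2)"
    using params by (intro mult_right_mono) auto
  hence e: "3 * (real K)\<^sup>2 * \<eta> * \<theta> * (real n)\<^sup>2 \<le> (real n * \<theta>)\<^sup>2 / 2"
    by (simp add: power2_eq_square mult_ac)
  have "(real n * \<theta>)\<^sup>2 \<le> (real n * s)\<^sup>2"
    using s_bounds params by (intro power_mono mult_left_mono) auto
  thus "(real n * \<theta>)\<^sup>2 / 2 \<le> Ncount m Y i j"
    using Ncount_approx[OF assms] e by linarith
  have "(real n * s)\<^sup>2 \<le> (real n * (real K * \<theta>))\<^sup>2"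
    using s_bounds params by (intro power_mono mult_left_mono) auto
  also have "\<dots> = (real K)\<^sup>2 * (real n * \<theta>)\<^sup>2" by (simp add: power_mult_distrib)
  finally have "(real n * s)\<^sup>2 \<le> (real K)\<^sup>2 * (real n * \<theta>)\<^sup>2" .
  moreover have "1 * (real n * \<theta>)\<^sup>2 \<le> (real K)\<^sup>2 * (real n * \<theta>)\<^sup>2"
    using K_pos by (intro mult_right_mono) auto
  moreover have "0 \<le> (real n * \<theta>)\<^sup>2" by simp
  ultimately show "Ncount m Y i j \<le> 2 * (real K)\<^sup>2 * (real n * \<theta>)\<^sup>2"
    using Ncount_approx[OF assms] e unfolding mult.assoc by linarith
qed

text \<open>Three-step walks from \<open>i\<close> to \<open>j\<close> whose two inner vertices
  avoid both endpoints; for \<open>i = j\<close> these are closed walks around triangles.\<close>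

definition "walks i j = (\<Sum>l\<in>V i - {j}. \<Sum>k\<in>V j - {i}. Y l k)"

abbreviation "p i j \<equiv> pair_density K \<theta> \<rho> (z i = z j)"

lemma s2_pair_density:
  assumes "i < m" "j < m"
  shows "s\<^sup>2 * p i j = \<rho> * s\<^sup>2 + (\<theta> - \<rho>) * (\<Sum>a<K. conn \<theta> \<rho> (z i) a * conn \<theta> \<rho> (z j) a)"
proof -
  have "s > 0" using s_bounds params by linarith
  moreover have "p i j = \<rho> + (\<theta> - \<rho>) * (\<Sum>a<K. conn \<theta> \<rho> (z i) a * conn \<theta> \<rho> (z j) a) / s\<^sup>2"
    unfolding sum_conn_mult[OF z_less[OF assms(1)] z_less[OF assms(2)]] pair_density_def s_def ..
  ultimately show ?thesis by (simp add: distrib_left)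
qed

text \<open>The density interpolates between \<open>\<rho>\<close> and \<open>\<theta>\<close> with
  weight \<open>w / s^2\<close>, and \<open>w \<le> s^2\<close> by comparison with the expanded
  square.\<close>

lemma pair_density_bounds: "\<rho> \<le> pair_density K \<theta> \<rho> b" "pair_density K \<theta> \<rho> b \<le> \<theta>"
proof -
  have s: "s > 0" using s_bounds params by linarith
  define w where "w = real K * \<rho>\<^sup>2 + 2 * \<rho> * (\<theta> - \<rho>) + (\<theta> - \<rho>)\<^sup>2 * of_bool b"
  have "0 \<le> w" using params by (simp add: w_def)
  have "w \<le> real K * \<rho>\<^sup>2 + 2 * \<rho> * (\<theta> - \<rho>) + (\<theta> - \<rho>)\<^sup>2"
    by (simp add: w_def)
  also have "\<dots> \<le> (real K * real K) * \<rho>\<^sup>2 + (2 * real K) * (\<rho> * (\<theta> - \<rho>)) + (\<theta> - \<rho>)\<^sup>2"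
  proof -
    have "(1 * real K) * \<rho>\<^sup>2 \<le> (real K * real K) * \<rho>\<^sup>2"
      using K_pos by (intro mult_right_mono) auto
    moreover have "2 * (\<rho> * (\<theta> - \<rho>)) \<le> (2 * real K) * (\<rho> * (\<theta> - \<rho>))"
      using K_pos params by (intro mult_right_mono) auto
    ultimately show ?thesis by (simp add: mult.assoc)
  qed
  also have "\<dots> = s\<^sup>2" by (simp add: s_def power2_eq_square algebra_simps)
  finally have "w \<le> s\<^sup>2" .
  hence "(\<theta> - \<rho>) * w \<le> (\<theta> - \<rho>) * s\<^sup>2" using params by (intro mult_left_mono) auto
  hence "(\<theta> - \<rho>) * w / s\<^sup>2 \<le> \<theta> - \<rho>" using s by (simp add: divide_le_eq)
  moreover have "0 \<le> (\<theta> - \<rho>) * w / s\<^sup>2" using params \<open>0 \<le> w\<close> by simp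
  moreover have "pair_density K \<theta> \<rho> b = \<rho> + (\<theta> - \<rho>) * w / s\<^sup>2"
    by (simp add: pair_density_def w_def s_def)
  ultimately show "\<rho> \<le> pair_density K \<theta> \<rho> b" "pair_density K \<theta> \<rho> b \<le> \<theta>"
    by linarith+
qed

end

text \<open>Kept apart from \<open>sbm_rows\<close> because the neighbourhood size bound, which
  follows from the rows alone, is what removes the truncation when \<open>devs\<close> is
  established.\<close>

locale sbm_graph = sbm_rows +
  assumes devs: "\<And>i j. i < n * K \<Longrightarrow> j < n * K \<Longrightarrow>
      \<bar>edge_dev z \<theta> \<rho> x (nb (n * K) x i - {j}) (nb (n * K) x j - {i})\<bar> \<le> \<eta> * (real n * \<theta>)\<^sup>2"
begin

text \<open>The walk count splits into the edge deviation, the mean over all pairs and a diagonal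
  correction. The first and last cost \<open>\<eta> * (n * \<theta>)^2\<close> each, the
  neighbourhood compositions three times \<open>K^2\<close> times that.\<close>

lemma walks_approx:
  assumes ij: "i < m" "j < m"
  shows "\<bar>walks i j - p i j * (real n * s)\<^sup>2\<bar> \<le> 5 * (real K)\<^sup>2 * \<eta> * (real n * \<theta>)\<^sup>2"
proof -
  define A B where "A = V i - {j}" and "B = V j - {i}"
  define ca where "ca = (\<lambda>a. real (card {l \<in> A. z l = a}))"
  define cb where "cb = (\<lambda>a. real (card {l \<in> B. z l = a}))"
  define q where "q = (\<Sum>a<K. conn \<theta> \<rho> (z i) a * conn \<theta> \<rho> (z j) a)"
  have AB: "A \<subseteq> {..<m}" "B \<subseteq> {..<m}" "finite A" "finite B" by (auto simp: A_def B_def nb_def)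
  have "walks i j = edge_dev z \<theta> \<rho> x A B + (\<Sum>l\<in>A. \<Sum>k\<in>B. of_bool (l \<noteq> k) * conn \<theta> \<rho> (z l) (z k))"
    unfolding edge_dev_def walks_def A_def[symmetric] B_def[symmetric] sum.distrib[symmetric]
    by (intro sum.cong refl) (auto simp: adj_def no_loops algebra_simps)
  \<comment> \<open>A vertex in both sets has no loop, while \<open>conn\<close> would assign it the
    mean \<open>\<theta>\<close>; this is subtracted.\<close>
  also have "(\<Sum>l\<in>A. \<Sum>k\<in>B. of_bool (l \<noteq> k) * conn \<theta> \<rho> (z l) (z k)) =
      (\<Sum>l\<in>A. \<Sum>k\<in>B. conn \<theta> \<rho> (z l) (z k) - (if k = l then \<theta> else 0))"
    by (intro sum.cong refl) (auto simp: conn_def)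
  also have "\<dots> = (\<Sum>l\<in>A. \<Sum>k\<in>B. conn \<theta> \<rho> (z l) (z k)) - (\<Sum>l\<in>A. if l \<in> B then \<theta> else 0)"
    using AB by (simp add: sum_subtractf)
  finally have walks: "walks i j = edge_dev z \<theta> \<rho> x A B +
      (\<rho> * (real (card A) * real (card B)) + (\<theta> - \<rho>) * (\<Sum>a<K. ca a * cb a)) -
      (\<Sum>l\<in>A. if l \<in> B then \<theta> else 0)"
    using AB by (simp add: sum_conn_pairs ca_def cb_def)
  have \<theta>: "0 < \<theta>" using params by linarith
  have diag: "0 \<le> (\<Sum>l\<in>A. if l \<in> B then \<theta> else 0)"
    "(\<Sum>l\<in>A. if l \<in> B then \<theta> else 0) \<le> \<eta> * (real n * \<theta>)\<^sup>2"
  proof -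
    show "0 \<le> (\<Sum>l\<in>A. if l \<in> B then \<theta> else 0)" using \<theta> by (intro sum_nonneg) auto
    have "(\<Sum>l\<in>A. if l \<in> B then \<theta> else 0) \<le> (\<Sum>l\<in>A. \<theta>)" using \<theta> by (intro sum_mono) auto
    also have "\<dots> = real (card A) * \<theta>" by simp
    also have "\<dots> \<le> real (card (V i)) * \<theta>"
      using \<theta> by (intro mult_right_mono of_nat_mono card_mono) (auto simp: A_def)
    also have "\<dots> \<le> 2 * (real K * (real n * \<theta>)) * \<theta>"
      using \<theta> card_nb_le[OF ij(1)] by (intro mult_right_mono) auto
    also have "\<dots> = (2 * real K) * (real n * \<theta>\<^sup>2)" by (simp add: power2_eq_square)
    \<comment> \<open>The diagonal is of lower order by a factor \<open>n\<close>; the assumption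
      \<open>2 * K \<le> \<eta> * n\<close> serves to absorb it.\<close>
    also have "\<dots> \<le> (\<eta> * real n) * (real n * \<theta>\<^sup>2)"
      using \<eta> by (intro mult_right_mono) auto
    also have "\<dots> = \<eta> * (real n * \<theta>)\<^sup>2" by (simp add: power2_eq_square)
    finally show "(\<Sum>l\<in>A. if l \<in> B then \<theta> else 0) \<le> \<eta> * (real n * \<theta>)\<^sup>2" .
  qed
  have classes: "\<bar>ca a * cb a - (real n * conn \<theta> \<rho> (z i) a) * (real n * conn \<theta> \<rho> (z j) a)\<bar>
      \<le> 3 * (\<eta> * real n) * (real n * \<theta>)" if "a < K" for a
  proof (rule abs_mult_diff_le)
    show "\<bar>ca a - real n * conn \<theta> \<rho> (z i) a\<bar> \<le> \<eta> * real n"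
      "\<bar>cb a - real n * conn \<theta> \<rho> (z j) a\<bar> \<le> \<eta> * real n"
      using class_count ij that by (simp_all add: ca_def cb_def A_def B_def)
    show "\<eta> * real n \<le> real n * \<theta>" using mult_right_mono[OF eta_le(2), of "real n"] by (simp add: mult.commute)
  qed (use conn_nonneg conn_le in \<open>auto intro: mult_left_mono\<close>)
  have "(\<Sum>a<K. ca a * cb a) - (real n)\<^sup>2 * q =
      (\<Sum>a<K. ca a * cb a - (real n * conn \<theta> \<rho> (z i) a) * (real n * conn \<theta> \<rho> (z j) a))"
    by (simp add: q_def sum_subtractf sum_distrib_left power2_eq_square mult_ac)
  also have "\<bar>\<dots>\<bar> \<le> (\<Sum>a<K. 3 * (\<eta> * real n) * (real n * \<theta>))"
    by (rule order_trans[OF sum_abs]) (use classes in \<open>intro sum_mono, auto\<close>)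
  also have "\<dots> = real K * (3 * \<eta> * \<theta> * (real n)\<^sup>2)" by (simp add: power2_eq_square mult_ac)
  also have "\<dots> \<le> (real K)\<^sup>2 * (3 * \<eta> * \<theta> * (real n)\<^sup>2)"
    using K_pos \<eta> \<theta> by (intro mult_right_mono) (auto simp: power2_eq_square)
  finally have e2: "\<bar>(\<Sum>a<K. ca a * cb a) - (real n)\<^sup>2 * q\<bar> \<le> (real K)\<^sup>2 * (3 * \<eta> * \<theta> * (real n)\<^sup>2)" .
  have "\<bar>real (card A) * real (card B) - (real n * s) * (real n * s)\<bar>
      \<le> 3 * (real K * (\<eta> * real n)) * (real n * (real K * \<theta>))"
  proof (rule abs_mult_diff_le)
    show "\<bar>real (card A) - real n * s\<bar> \<le> real K * (\<eta> * real n)"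
      "\<bar>real (card B) - real n * s\<bar> \<le> real K * (\<eta> * real n)"
      using card_nb_Diff ij by (simp_all add: A_def B_def)
    have "real n * (real K * \<eta>) \<le> real n * (real K * \<theta>)"
      using eta_le by (intro mult_left_mono) auto
    thus "real K * (\<eta> * real n) \<le> real n * (real K * \<theta>)" by (simp add: mult_ac)
  qed (use s_bounds \<theta> in \<open>auto intro: mult_left_mono\<close>)
  hence e1: "\<bar>real (card A) * real (card B) - (real n * s)\<^sup>2\<bar> \<le> (real K)\<^sup>2 * (3 * \<eta> * \<theta> * (real n)\<^sup>2)"
    by (simp add: power2_eq_square mult_ac)
  \<comment> \<open>Both composition errors have the same bound and are weighted by
    \<open>\<rho>\<close> and \<open>\<theta> - \<rho>\<close>, so together they cost it
    \<open>\<theta>\<close> times.\<close>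
  have "\<bar>\<rho> * (real (card A) * real (card B)) + (\<theta> - \<rho>) * (\<Sum>a<K. ca a * cb a) - p i j * (real n * s)\<^sup>2\<bar>
      = \<bar>\<rho> * (real (card A) * real (card B) - (real n * s)\<^sup>2) +
          (\<theta> - \<rho>) * ((\<Sum>a<K. ca a * cb a) - (real n)\<^sup>2 * q)\<bar>"
  proof -
    have "p i j * (real n * s)\<^sup>2 = (real n)\<^sup>2 * (s\<^sup>2 * p i j)" by (simp add: power_mult_distrib mult_ac)
    thus ?thesis unfolding s2_pair_density[OF ij] q_def[symmetric]
      by (simp add: power_mult_distrib algebra_simps)
  qed
  also have "\<dots> \<le> \<rho> * \<bar>real (card A) * real (card B) - (real n * s)\<^sup>2\<bar> +
      (\<theta> - \<rho>) * \<bar>(\<Sum>a<K. ca a * cb a) - (real n)\<^sup>2 * q\<bar>"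
    using params by (intro order_trans[OF abs_triangle_ineq]) (simp add: abs_mult)
  also have "\<dots> \<le> \<rho> * ((real K)\<^sup>2 * (3 * \<eta> * \<theta> * (real n)\<^sup>2)) + (\<theta> - \<rho>) * ((real K)\<^sup>2 * (3 * \<eta> * \<theta> * (real n)\<^sup>2))"
    using e1 e2 params by (intro add_mono mult_left_mono) auto
  also have "\<dots> = 3 * ((real K)\<^sup>2 * (\<eta> * (real n * \<theta>)\<^sup>2))"
    by (simp add: power2_eq_square algebra_simps)
  finally have main: "\<bar>\<rho> * (real (card A) * real (card B)) + (\<theta> - \<rho>) * (\<Sum>a<K. ca a * cb a) -
      p i j * (real n * s)\<^sup>2\<bar> \<le> 3 * ((real K)\<^sup>2 * (\<eta> * (real n * \<theta>)\<^sup>2))" .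
  have "1 * (\<eta> * (real n * \<theta>)\<^sup>2) \<le> (real K)\<^sup>2 * (\<eta> * (real n * \<theta>)\<^sup>2)"
    using K_pos \<eta> by (intro mult_right_mono) auto
  hence "\<bar>walks i j - p i j * (real n * s)\<^sup>2\<bar> \<le> 5 * ((real K)\<^sup>2 * (\<eta> * (real n * \<theta>)\<^sup>2))"
    using main diag devs[OF ij, folded A_def B_def] unfolding walks by linarith
  thus ?thesis by (simp add: mult.assoc)
qed

end

section \<open>The two statistics and exact recovery on accurate graphs\<close>

context sbm_graph begin

text \<open>Replacing the ideal normalisation \<open>(n * s)^2\<close> by the observed one adds 3 to
  the constant 5.\<close>

lemma walks_Ncount:
  assumes ij: "i < m" "j < m"
  shows "\<bar>walks i j - p i j * Ncount m Y i j\<bar> \<le> 8 * ((real K)\<^sup>2 * (\<eta> * (real n * \<theta>)\<^sup>2))"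
proof -
  have p: "0 \<le> p i j" "p i j \<le> \<theta>" using pair_density_bounds[of "z i = z j"] params by auto
  have "\<bar>p i j * (Ncount m Y i j - (real n * s)\<^sup>2)\<bar> = p i j * \<bar>Ncount m Y i j - (real n * s)\<^sup>2\<bar>"
    using p by (simp add: abs_mult)
  also have "\<dots> \<le> \<theta> * (3 * (real K)\<^sup>2 * \<eta> * \<theta> * (real n)\<^sup>2)"
    using p Ncount_approx[OF ij] by (intro mult_mono) auto
  also have "\<dots> = 3 * ((real K)\<^sup>2 * (\<eta> * (real n * \<theta>)\<^sup>2))"
    by (simp add: power2_eq_square)
  finally have "\<bar>p i j * (Ncount m Y i j - (real n * s)\<^sup>2)\<bar> \<le> 3 * ((real K)\<^sup>2 * (\<eta> * (real n * \<theta>)\<^sup>2))" .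
  thus ?thesis using walks_approx[OF ij] by (simp add: right_diff_distrib mult.assoc)
qed

text \<open>The extra walks run through the edge between \<open>i\<close> and \<open>j\<close>:
  those with \<open>l = j\<close> number \<open>card (V j)\<close>, those with \<open>k = i\<close>
  number \<open>card (V i)\<close>, and the walk with both is counted twice.\<close>

lemma S_orig_adj:
  assumes ij: "i < m" "j < m"
  shows "S_orig m Y i j = walks i j + of_bool (x {i, j}) * (real (card (V i)) + real (card (V j)) - 1)"
proof -
  have Y_V: "Y a b = of_bool (b \<in> V a)" if "b < m" for a b
    using that no_loops by (auto simp: adj_def nb_def)
  have sym: "Y a b = Y b a" for a b by (simp add: adj_def insert_commute)
  have fin: "finite (V a)" for a by simp
  have row: "(\<Sum>k<m. Y a k * f k) = (\<Sum>k\<in>V a. f k)" for a and f :: "nat \<Rightarrow> real"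
    by (intro sum.mono_neutral_cong_right) (auto simp: nb_def adj_def no_loops)
  have "S_orig m Y i j = (\<Sum>l<m. Y i l * (\<Sum>k<m. Y j k * Y l k))"
    by (simp add: S_orig_def sum_distrib_left sym[of j] mult_ac)
  hence S: "S_orig m Y i j = (\<Sum>l\<in>V i. \<Sum>k\<in>V j. Y l k)" by (simp add: row)
  show ?thesis
  proof (cases "x {i, j}")
    case False
    hence "V i - {j} = V i" "V j - {i} = V j" by (auto simp: nb_def insert_commute)
    thus ?thesis using False by (simp add: S walks_def)
  next
    case True
    hence "i \<noteq> j" using no_loops by auto
    define A B where "A = V i - {j}" and "B = V j - {i}"
    have VA: "V i = insert j A" "V j = insert i B"
      using True ij \<open>i \<noteq> j\<close> by (auto simp: A_def B_def nb_def insert_commute)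
    have AB: "finite A" "finite B" "j \<notin> A" "i \<notin> B" by (auto simp: A_def B_def)
    have "Y l i = 1" if "l \<in> A" for l
      using that by (auto simp: A_def nb_def adj_def insert_commute)
    hence 1: "(\<Sum>l\<in>A. Y l i) = real (card A)" by simp
    have "Y j k = 1" if "k \<in> B" for k
      using that by (auto simp: B_def nb_def adj_def)
    hence 2: "(\<Sum>k\<in>B. Y j k) = real (card B)" by simp
    have 3: "Y j i = 1" using True by (simp add: adj_def insert_commute)
    have "S_orig m Y i j = (\<Sum>l\<in>insert j A. \<Sum>k\<in>insert i B. Y l k)"
      unfolding S VA ..
    also have "\<dots> = (Y j i + (\<Sum>k\<in>B. Y j k)) + ((\<Sum>l\<in>A. Y l i) + (\<Sum>l\<in>A. \<Sum>k\<in>B. Y l k))"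
      using AB by (simp add: sum.distrib)
    also have "(\<Sum>l\<in>A. \<Sum>k\<in>B. Y l k) = walks i j"
      by (simp add: walks_def A_def B_def)
    finally have "S_orig m Y i j = 1 + real (card B) + real (card A) + walks i j"
      by (simp add: 1 2 3)
    moreover have "card (V i) = card A + 1" "card (V j) = card B + 1"
      using AB by (simp_all add: VA)
    ultimately show ?thesis using True by simp
  qed
qed

lemma S_corr_adj:
  assumes "i < m" "j < m"
  shows "S_corr m Y i j = walks i j"
  by (simp add: S_corr_def S_orig_adj[OF assms] nbhd_adj) (simp add: adj_def)

text \<open>The extra walks number at most \<open>4 * K * n * \<theta>\<close>. The premise
  \<open>big\<close> turns this into 2 more units of the error, on top of the 8 from
  \<open>walks_Ncount\<close>.\<close>

lemma S_orig_Ncount: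
  assumes ij: "i < m" "j < m" and big: "2 \<le> \<eta> * (real n * \<theta>)"
  shows "\<bar>S_orig m Y i j - p i j * Ncount m Y i j\<bar> \<le> 10 * ((real K)\<^sup>2 * (\<eta> * (real n * \<theta>)\<^sup>2))"
proof -
  define r where "r = of_bool (x {i, j}) * (real (card (V i)) + real (card (V j)) - 1)"
  have "j \<in> V i" if "x {i, j}" using that ij no_loops[of i] by (auto simp: nb_def)
  hence "1 \<le> card (V i)" if "x {i, j}" using that card_gt_0_iff[of "V i"] by fastforce
  hence "1 \<le> real (card (V i))" if "x {i, j}" using that by fastforce
  hence "0 \<le> r" by (cases "x {i, j}") (auto simp: r_def add_increasing2)
  have t: "0 \<le> real K * (real n * \<theta>)" using params by simp
  hence "r \<le> 4 * (real K * (real n * \<theta>))"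
    using card_nb_le[OF ij(1)] card_nb_le[OF ij(2)] by (auto simp: r_def of_bool_def)
  also have "\<dots> = 2 * (real K * (2 * (real n * \<theta>)))" by simp
  also have "\<dots> \<le> 2 * (real K * ((\<eta> * (real n * \<theta>)) * (real n * \<theta>)))"
    using big params by (intro mult_left_mono mult_right_mono) auto
  also have "\<dots> = 2 * (real K * (\<eta> * (real n * \<theta>)\<^sup>2))" by (simp add: power2_eq_square mult_ac)
  also have "\<dots> \<le> 2 * ((real K)\<^sup>2 * (\<eta> * (real n * \<theta>)\<^sup>2))"
    using K_pos \<eta>(1) by (intro mult_left_mono mult_right_mono) (auto simp: power2_eq_square)
  finally show ?thesis
    using walks_Ncount[OF ij] \<open>0 \<le> r\<close> unfolding S_orig_adj[OF ij] r_def[symmetric] by linarith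
qed

text \<open>Stated with the constant 10 so that both statistics meet the same premise of
  \<open>recovers\<close>.\<close>

lemma S_corr_Ncount:
  assumes ij: "i < m" "j < m"
  shows "\<bar>S_corr m Y i j - p i j * Ncount m Y i j\<bar> \<le> 10 * ((real K)\<^sup>2 * (\<eta> * (real n * \<theta>)\<^sup>2))"
proof -
  have "0 \<le> (real K)\<^sup>2 * (\<eta> * (real n * \<theta>)\<^sup>2)" using \<eta> by simp
  thus ?thesis using walks_Ncount[OF ij] unfolding S_corr_adj[OF ij] by linarith
qed

lemma pair_density_gap:
  "pair_density K \<theta> \<rho> True - pair_density K \<theta> \<rho> False = density_gap K \<theta> \<rho>"
  by (simp add: pair_density_def density_gap_def power2_eq_square power3_eq_cube algebra_simps
      add_divide_distrib flip: diff_divide_distrib)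

text \<open>Within a community \<open>T\<close> is at most
  \<open>n^2 * \<theta> * D^2 / 400\<close>, across communities at least
  \<open>n^2 * \<theta> * D^2 / 192\<close>, so the former value separates them.\<close>

lemma recovers:
  assumes ij: "i < m" "j < m"
    and S: "\<And>a b. a < m \<Longrightarrow> b < m \<Longrightarrow>
        \<bar>S a b - p a b * Ncount m Y a b\<bar> \<le> 10 * ((real K)\<^sup>2 * (\<eta> * (real n * \<theta>)\<^sup>2))"
    and C: "1 \<le> C" "\<theta> \<le> C * \<rho>"
    and \<eta>_def: "\<eta> = density_gap K \<theta> \<rho> / (6000 * real K ^ 3 * C)"
  shows "of_bool (T_stat m Y S i j \<le> (real n)\<^sup>2 * \<theta> * (density_gap K \<theta> \<rho>)\<^sup>2 / 400) = Wstar z i j"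
proof -
  define D where "D = density_gap K \<theta> \<rho>"
  define g where "g = 20 * (real K)\<^sup>2 * \<eta>"
  let ?I = "{(i, i), (j, j), (i, j)}"
  have \<theta>: "0 < \<theta>" using params by linarith
  have s: "s > 0" using s_bounds \<theta> by linarith
  have nt: "0 < real n * \<theta>" using n_pos \<theta> by simp
  have D: "0 < D" using s params by (simp add: D_def density_gap_def s_def[symmetric])
  have D\<theta>: "D \<le> \<theta>"
    using pair_density_bounds[of True] pair_density_bounds[of False] pair_density_gap params
    by (simp add: D_def)
  have gD: "g = D / (300 * real K * C)"
    using K_pos C by (simp add: g_def \<eta>_def D_def power2_eq_square power3_eq_cube)
  \<comment> \<open>Two consequences of \<open>g = D / (300 * K * C)\<close> are needed:
    \<open>g\<close> is small against the gap \<open>D\<close>, and small against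
    \<open>\<theta> / C \<le> \<rho>\<close>, which keeps the estimators away from 0.\<close>
  have "300 * (1 * 1) \<le> 300 * (real K * C)" using K_pos C by (intro mult_left_mono mult_mono) auto
  moreover have "300 * (1 * C) \<le> 300 * (real K * C)" using K_pos C by (intro mult_left_mono mult_right_mono) auto
  ultimately have KC: "300 \<le> 300 * real K * C" "300 * C \<le> 300 * real K * C" by simp_all
  have g4: "0 < g" "g \<le> D / 300" "g \<le> \<theta> / (300 * C)"
  proof -
    show "0 < g" unfolding gD using D KC by (intro divide_pos_pos) linarith+
    show "g \<le> D / 300" unfolding gD using D KC by (intro divide_left_mono) auto
    show "g \<le> \<theta> / (300 * C)" unfolding gD using D D\<theta> KC C \<theta> by (intro frac_le) auto
  qed
  have C\<rho>: "\<theta> / C \<le> \<rho>" using C by (simp add: divide_le_eq mult.commute)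
  have "\<theta> / (300 * C) = \<theta> / C / 300" "\<theta> / (2 * C) = \<theta> / C / 2" using C by simp_all
  moreover have "0 < \<theta> / C" using \<theta> C by simp
  ultimately have low: "\<theta> / (2 * C) \<le> \<rho> - g" "0 < \<theta> / (2 * C)" using g4 C\<rho> by linarith+
  have N: "(real n * \<theta>)\<^sup>2 / 2 \<le> Ncount m Y a b \<and> Ncount m Y a b \<le> 2 * (real K)\<^sup>2 * (real n * \<theta>)\<^sup>2"
    if "(a, b) \<in> ?I" for a b
    using that ij Ncount_bounds by auto
  have h: "0 < (real n * \<theta>)\<^sup>2 / 2" using n_pos \<theta> by simp
  have est: "\<bar>theta_est m Y S a b - p a b\<bar> \<le> g" if I: "(a, b) \<in> ?I" for a b
  proof -
    have Npos: "0 < Ncount m Y a b" using N[OF I] h by linarith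
    have "theta_est m Y S a b - p a b = (S a b - p a b * Ncount m Y a b) / Ncount m Y a b"
      using Npos by (simp add: theta_est_def diff_divide_distrib)
    hence "\<bar>theta_est m Y S a b - p a b\<bar> = \<bar>S a b - p a b * Ncount m Y a b\<bar> / Ncount m Y a b"
      using Npos by simp
    \<comment> \<open>Dividing by the lower bound \<open>(n * \<theta>)^2 / 2\<close> of
      \<open>Ncount\<close> yields exactly \<open>g\<close>.\<close>
    also have "\<dots> \<le> 10 * ((real K)\<^sup>2 * (\<eta> * (real n * \<theta>)\<^sup>2)) / ((real n * \<theta>)\<^sup>2 / 2)"
      using S[of a b] I ij N[OF I] h \<eta>(1) by (intro frac_le) auto
    also have "\<dots> = g" using n_pos \<theta> by (simp add: g_def)
    finally show ?thesis .
  qed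
  show ?thesis
  proof (cases "z i = z j")
    case True
    have "T_stat m Y S i j \<le> 48 * (2 * (real K)\<^sup>2 * (real n * \<theta>)\<^sup>2) * g\<^sup>2 / (\<theta> / (2 * C))"
    proof (rule T_stat_le)
      show "0 < Ncount m Y a b \<and> Ncount m Y a b \<le> 2 * (real K)\<^sup>2 * (real n * \<theta>)\<^sup>2"
        if "(a, b) \<in> ?I" for a b
        using N[OF that] h by linarith
      show "\<bar>theta_est m Y S a b - p i j\<bar> \<le> g" if "(a, b) \<in> ?I" for a b
        using est[OF that] that True by auto
      show "\<theta> / (2 * C) \<le> p i j - g" "p i j + g \<le> 3 / 4"
        using low pair_density_bounds[of "z i = z j"] g4 D D\<theta> params by linarith+
    qed (use low in auto)
    also have "\<dots> = (192 * (real K)\<^sup>2 * C) * g\<^sup>2 * ((real n)\<^sup>2 * \<theta>)"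
      using \<theta> C by (simp add: power2_eq_square field_simps)
    also have "\<dots> \<le> (D\<^sup>2 / 400) * ((real n)\<^sup>2 * \<theta>)"
    proof (rule mult_right_mono)
      \<comment> \<open>The factor \<open>K * C\<close> in the denominator of \<open>g\<close> pays
        for \<open>K^2\<close> and \<open>C\<close>; numerically,
        \<open>192 / 90000 \<le> 1 / 400\<close>.\<close>
      have "(192 * (real K)\<^sup>2 * C) * g\<^sup>2 = 192 * D\<^sup>2 / (90000 * C)"
        using K_pos C by (simp add: gD power_divide power_mult_distrib) (simp add: power2_eq_square)
      also have "\<dots> \<le> 192 * D\<^sup>2 / 90000"
        using C by (intro divide_left_mono) auto
      also have "\<dots> \<le> D\<^sup>2 / 400" by simp
      finally show "(192 * (real K)\<^sup>2 * C) * g\<^sup>2 \<le> D\<^sup>2 / 400" .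
    qed (use \<theta> in simp)
    finally show ?thesis using True by (simp add: Wstar_def D_def mult_ac)
  next
    case False
    have pp: "p a b + g \<le> 3 / 2 * \<theta>" "\<rho> - g \<le> p a b - g" for a b
      using pair_density_bounds[of "z a = z b"] g4 D D\<theta> by linarith+
    have "(real n * \<theta>)\<^sup>2 / 2 * (D / 2)\<^sup>2 / (16 * (3 / 2 * \<theta>)) \<le> T_stat m Y S i j"
    proof (rule T_stat_ge)
      show "\<theta> / (2 * C) \<le> theta_est m Y S a b \<and> theta_est m Y S a b \<le> 3 / 2 * \<theta>"
        if "(a, b) \<in> ?I" for a b
        using est[OF that] pp[of a b] low by linarith
      \<comment> \<open>A vertex always shares its own community, so the diagonal density is the
        larger one. The errors \<open>2 * g\<close> are far below \<open>D / 2\<close>.\<close>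
      have "p i i - p i j = D" using False pair_density_gap by (simp add: D_def)
      thus "D / 2 \<le> \<bar>theta_est m Y S i i - theta_est m Y S i j\<bar>"
        using est[of i i] est[of i j] g4 D by simp
    qed (use N h low params D in auto)
    also have "(real n * \<theta>)\<^sup>2 / 2 * (D / 2)\<^sup>2 / (16 * (3 / 2 * \<theta>)) = (real n)\<^sup>2 * \<theta> * D\<^sup>2 / 192"
      using \<theta> by (simp add: power2_eq_square)
    finally have "(real n)\<^sup>2 * \<theta> * D\<^sup>2 / 192 \<le> T_stat m Y S i j" .
    moreover have "0 < (real n)\<^sup>2 * \<theta> * D\<^sup>2" using D \<theta> n_pos by simp
    ultimately show ?thesis using False by (simp add: Wstar_def D_def)
  qed
qed

end

section \<open>Probability of an accurate graph\<close>

lemma SBM_adj: "SBM n K z \<theta> \<rho> = map_pmf adj (edge_pmf (edges (n * K)) z \<theta> \<rho>)"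
  by (simp add: SBM_def edge_pmf_def edges_def edge_prob_def[abs_def] adj_def[abs_def])

text \<open>The two centrings differ only at \<open>k = i\<close>, which \<open>edge_dev\<close>
  omits and \<open>n * conn\<close> includes.\<close>

lemma edge_dev_row:
  assumes "balanced_communities n K z" "a < K" "x {i} = False"
  shows "\<bar>(real (card {l \<in> nb (n * K) x i. z l = a}) - real n * conn \<theta> \<rho> (z i) a) -
           edge_dev z \<theta> \<rho> x {i} {l. l < n * K \<and> z l = a}\<bar> \<le> \<bar>conn \<theta> \<rho> (z i) a\<bar>"
proof -
  define B where "B = {l. l < n * K \<and> z l = a}"
  have fin: "finite B" by (simp add: B_def)
  have card: "card B = n" using assms(1,2) by (simp add: balanced_communities_def B_def lessThan_def Collect_conj_eq)
  have "edge_dev z \<theta> \<rho> x {i} B =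
      (\<Sum>k\<in>B. of_bool (k \<in> nb (n * K) x i) - conn \<theta> \<rho> (z i) a + (if k = i then conn \<theta> \<rho> (z i) a else 0))"
    unfolding edge_dev_def using assms(3)
    by (simp, intro sum.cong refl) (auto simp: B_def nb_def)
  also have "\<dots> = (\<Sum>k\<in>B. of_bool (k \<in> nb (n * K) x i)) - real n * conn \<theta> \<rho> (z i) a +
      (if i \<in> B then conn \<theta> \<rho> (z i) a else 0)"
    using fin by (simp add: sum.distrib sum_subtractf card del: sum_of_bool_eq)
  also have "(\<Sum>k\<in>B. of_bool (k \<in> nb (n * K) x i) :: real) = real (card {l \<in> nb (n * K) x i. z l = a})"
  proof -
    have "B \<inter> {k. k \<in> nb (n * K) x i} = {l \<in> nb (n * K) x i. z l = a}"
      by (auto simp: B_def nb_def)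
    thus ?thesis using fin by simp
  qed
  finally show ?thesis by (simp add: B_def[symmetric])
qed

lemma exp_neg_ln_le:
  assumes "3 * ln (real n) \<le> y" "n \<ge> 1"
  shows "exp (- y) \<le> 1 / real n ^ 3"
proof -
  have "exp (- y) \<le> exp (- (3 * ln (real n)))" using assms by simp
  also have "\<dots> = 1 / real n ^ 3"
    using assms by (simp add: exp_minus exp_of_nat_mult[of 3, simplified] inverse_eq_divide)
  finally show ?thesis .
qed

text \<open>A union bound over \<open>n * K^2\<close> row events and \<open>(n * K)^2\<close> pair
  events, each of probability at most \<open>2 / n^3\<close>. The two rates make the respective
  exponents at least \<open>3 * ln n\<close>.\<close>

lemma prob_sbm_graph_ge:
  assumes bal: "balanced_communities n K z" and K: "K \<ge> 1" and n: "n \<ge> 1"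
    and params: "0 < \<rho>" "\<rho> < \<theta>" "\<theta> \<le> 1 / 2"
    and \<eta>: "0 < \<eta>" "6 * (real K)\<^sup>2 * \<eta> \<le> \<theta>" "2 * real K \<le> \<eta> * real n"
    and rate: "384 * \<theta> * ln (real n) \<le> \<eta>\<^sup>2 * real n"
      "96 * (real K)\<^sup>2 * ln (real n) \<le> \<eta>\<^sup>2 * (real n)\<^sup>2 * \<theta>"
  shows "measure_pmf.prob (edge_pmf (edges (n * K)) z \<theta> \<rho>) {x. sbm_graph n K \<theta> \<rho> \<eta> z x}
           \<ge> 1 - 4 * (real K)\<^sup>2 / real n"
proof -
  let ?P = "edge_pmf (edges (n * K)) z \<theta> \<rho>"
  define m where "m = n * K"
  define U where "U = 2 * (real K * (real n * \<theta>))"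
  define R where "R = (\<lambda>(i, a). {x. \<eta> * real n / 4 \<le> \<bar>edge_dev z \<theta> \<rho> x {i} {l. l < m \<and> z l = a}\<bar>})"
  \<comment> \<open>The size restriction is part of the event, since the conditional bound requires
    it; it holds automatically once the rows are accurate.\<close>
  define Q where "Q = (\<lambda>(i, j). {x. real (card (nb m x i)) \<le> U \<and> real (card (nb m x j)) \<le> U \<and>
      \<eta> * (real n * \<theta>)\<^sup>2 \<le> \<bar>edge_dev z \<theta> \<rho> x (nb m x i - {j}) (nb m x j - {i})\<bar>})"
  define RI where "RI = {..<m} \<times> {..<K}"
  define QI where "QI = {..<m} \<times> {..<m}"
  have \<theta>: "0 < \<theta>" using params by linarith
  have npos: "1 \<le> real n" and Kpos: "1 \<le> real K" using n K by auto
  have "1 \<le> 6 * (real K)\<^sup>2" using one_le_power[OF Kpos, of 2] by linarith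
  hence "1 * \<eta> \<le> 6 * (real K)\<^sup>2 * \<eta>" using \<eta>(1) by (intro mult_right_mono) auto
  hence \<eta>\<theta>: "\<eta> \<le> \<theta>" using \<eta> by linarith
  have PR: "measure_pmf.prob ?P (R ia) \<le> 2 / real n ^ 3" if mem: "ia \<in> RI" for ia
  proof -
    obtain i a where ia: "ia = (i, a)" "i < m" "a < K" using mem by (auto simp: RI_def)
    have card: "card {l. l < m \<and> z l = a} = n"
      using bal ia by (simp add: balanced_communities_def m_def lessThan_def Collect_conj_eq)
    have "measure_pmf.prob ?P (R ia) \<le> 2 * exp (- (\<eta> * real n / 4)\<^sup>2 / (4 * (2 * real n * \<theta>)))"
      unfolding R_def ia(1) prod.case
    proof (rule edge_dev_concentration)
      show "\<eta> * real n / 4 \<le> 2 * real n * \<theta>"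
        using mult_right_mono[OF \<eta>\<theta>, of "real n"] npos \<theta> by (simp add: mult.commute)
    qed (use params ia n \<theta> \<eta>(1) card in \<open>auto simp: m_def pair_in_edges_iff\<close>)
    also have "- (\<eta> * real n / 4)\<^sup>2 / (4 * (2 * real n * \<theta>)) = - (\<eta>\<^sup>2 * real n / (128 * \<theta>))"
      using npos \<theta> by (simp add: power2_eq_square field_simps)
    also have "exp \<dots> \<le> 1 / real n ^ 3"
      using rate(1) \<theta> n by (intro exp_neg_ln_le) (auto simp: le_divide_eq mult_ac)
    finally show ?thesis by simp
  qed
  have PQ: "measure_pmf.prob ?P (Q ij) \<le> 2 / real n ^ 3" if mem: "ij \<in> QI" for ij
  proof -
    obtain i j where ij: "ij = (i, j)" "i < m" "j < m" using mem by (auto simp: QI_def)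
    have "measure_pmf.prob ?P (Q ij) \<le> 2 * exp (- (\<eta> * (real n * \<theta>)\<^sup>2)\<^sup>2 / (8 * U\<^sup>2 * \<theta>))"
      unfolding Q_def ij(1) prod.case m_def[symmetric]
    proof (rule nb_dev_concentration)
      show "0 < U" using npos Kpos \<theta> by (simp add: U_def)
      have "\<eta> * (real n * \<theta>)\<^sup>2 \<le> \<theta> * (real n * \<theta>)\<^sup>2"
        using \<eta>\<theta> by (intro mult_right_mono) auto
      also have "(real n * \<theta>)\<^sup>2 \<le> U\<^sup>2"
      proof (rule power_mono)
        have "1 * (real n * \<theta>) \<le> (2 * real K) * (real n * \<theta>)"
          using Kpos \<theta> by (intro mult_right_mono) auto
        thus "real n * \<theta> \<le> U" by (simp add: U_def)
      qed (use \<theta> in simp)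
      finally have "\<eta> * (real n * \<theta>)\<^sup>2 \<le> U\<^sup>2 * \<theta>"
        using \<theta> by (simp add: mult.commute mult_left_mono)
      moreover have "0 \<le> U\<^sup>2 * \<theta>" using \<theta> by simp
      ultimately show "\<eta> * (real n * \<theta>)\<^sup>2 \<le> 2 * U\<^sup>2 * \<theta>" by linarith
    qed (use params \<eta>(1) ij in auto)
    also have "- (\<eta> * (real n * \<theta>)\<^sup>2)\<^sup>2 / (8 * U\<^sup>2 * \<theta>) = - (\<eta>\<^sup>2 * (real n)\<^sup>2 * \<theta> / (32 * (real K)\<^sup>2))"
      using npos Kpos \<theta> by (simp add: U_def power2_eq_square field_simps)
    also have "exp \<dots> \<le> 1 / real n ^ 3"
      using rate(2) Kpos n by (intro exp_neg_ln_le) (auto simp: le_divide_eq mult_ac)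
    finally show ?thesis by simp
  qed
  have good: "sbm_graph n K \<theta> \<rho> \<eta> z x"
    if x: "x \<in> set_pmf ?P" and xR: "x \<notin> (\<Union>ia\<in>RI. R ia)" and xQ: "x \<notin> (\<Union>ij\<in>QI. Q ij)" for x
  proof -
    \<comment> \<open>Holds on the support only, where coordinates outside \<open>edges\<close> have
      the default value \<open>False\<close>; hence the intersection with \<open>set_pmf\<close>
      below.\<close>
    have no_loops: "\<not> x {i}" for i
    proof -
      have "{i} \<notin> edges (n * K)" by (simp add: edges_def)
      thus ?thesis using x set_Pi_pmf_subset[OF finite_edges] by (fastforce simp: edge_pmf_def)
    qed
    interpret sbm_rows n K \<theta> \<rho> \<eta> z x
    proof
      fix i a assume i: "i < n * K" and a: "a < K"
      \<comment> \<open>The remaining \<open>\<eta> * n / 4\<close> up to the required half is at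
        least \<open>1 / 2\<close> and covers the term for \<open>i\<close> itself.\<close>
      have "\<bar>edge_dev z \<theta> \<rho> x {i} {l. l < n * K \<and> z l = a}\<bar> < \<eta> * real n / 4"
        using xR i a by (auto simp: R_def RI_def m_def not_le)
      moreover have "\<bar>conn \<theta> \<rho> (z i) a\<bar> \<le> 1 / 2" using params by (auto simp: conn_def)
      moreover have "2 \<le> \<eta> * real n" using \<eta>(3) Kpos by linarith
      moreover have "\<bar>(real (card {l \<in> nb (n * K) x i. z l = a}) - real n * conn \<theta> \<rho> (z i) a) -
          edge_dev z \<theta> \<rho> x {i} {l. l < n * K \<and> z l = a}\<bar> \<le> \<bar>conn \<theta> \<rho> (z i) a\<bar>"
        using no_loops[of i] by (intro edge_dev_row[OF bal a]) simp
      ultimately show "\<bar>real (card {l \<in> nb (n * K) x i. z l = a}) - real n * conn \<theta> \<rho> (z i) a\<bar>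
          \<le> \<eta> * real n / 2"
        by linarith
    qed (use bal K n params \<eta> no_loops in auto)
    show ?thesis
    proof
      fix i j assume ij: "i < n * K" "j < n * K"
      hence "x \<notin> Q (i, j)" using xQ by (auto simp: QI_def m_def)
      thus "\<bar>edge_dev z \<theta> \<rho> x (nb (n * K) x i - {j}) (nb (n * K) x j - {i})\<bar> \<le> \<eta> * (real n * \<theta>)\<^sup>2"
        using card_nb_le ij by (auto simp: Q_def m_def U_def)
    qed
  qed
  have "measure_pmf.prob ?P (- {x. sbm_graph n K \<theta> \<rho> \<eta> z x}) =
      measure_pmf.prob ?P (- {x. sbm_graph n K \<theta> \<rho> \<eta> z x} \<inter> set_pmf ?P)"
    by (simp add: measure_Int_set_pmf)
  also have "\<dots> \<le> measure_pmf.prob ?P ((\<Union>ia\<in>RI. R ia) \<union> (\<Union>ij\<in>QI. Q ij))"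
    using good by (intro measure_pmf.finite_measure_mono) auto
  also have "\<dots> \<le> measure_pmf.prob ?P (\<Union>ia\<in>RI. R ia) + measure_pmf.prob ?P (\<Union>ij\<in>QI. Q ij)"
    by (rule measure_Un_le) auto
  also have "\<dots> \<le> (\<Sum>ia\<in>RI. measure_pmf.prob ?P (R ia)) + (\<Sum>ij\<in>QI. measure_pmf.prob ?P (Q ij))"
    by (intro add_mono measure_UNION_le) (auto simp: RI_def QI_def)
  also have "\<dots> \<le> (\<Sum>ia\<in>RI. 2 / real n ^ 3) + (\<Sum>ij\<in>QI. 2 / real n ^ 3)"
    using PR PQ by (intro add_mono sum_mono) auto
  also have "\<dots> = 2 * (real K)\<^sup>2 / (real n)\<^sup>2 + 2 * (real K)\<^sup>2 / real n"
    using npos by (simp add: RI_def QI_def m_def power2_eq_square power3_eq_cube mult_ac)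
  also have "\<dots> \<le> 2 * (real K)\<^sup>2 / real n + 2 * (real K)\<^sup>2 / real n"
    using npos by (intro add_mono divide_left_mono order_refl) (auto simp: power2_eq_square)
  finally have bad: "measure_pmf.prob ?P (- {x. sbm_graph n K \<theta> \<rho> \<eta> z x}) \<le> 4 * (real K)\<^sup>2 / real n"
    by simp
  have "measure_pmf.prob ?P (- {x. sbm_graph n K \<theta> \<rho> \<eta> z x}) =
      1 - measure_pmf.prob ?P {x. sbm_graph n K \<theta> \<rho> \<eta> z x}"
    using measure_pmf.prob_compl[of "{x. sbm_graph n K \<theta> \<rho> \<eta> z x}" ?P]
    by (simp add: Compl_eq_Diff_UNIV)
  thus ?thesis using bad by linarith
qed

text \<open>With \<open>u = \<theta> - \<rho>\<close> the gap is \<open>u^3 / s^2\<close>, and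
  \<open>u \<le> s \<le> K * \<theta>\<close>.\<close>

lemma density_gap_bounds:
  assumes "K \<ge> 1" "0 < \<rho>" "\<rho> < \<theta>"
  shows "0 < density_gap K \<theta> \<rho>" "density_gap K \<theta> \<rho> \<le> \<theta>"
    "(\<theta> - \<rho>) ^ 3 / ((real K)\<^sup>2 * \<theta>\<^sup>2) \<le> density_gap K \<theta> \<rho>"
proof -
  define u where "u = \<theta> - \<rho>"
  define s where "s = real K * \<rho> + u"
  have u: "0 < u" "u \<le> \<theta>" using assms by (auto simp: u_def)
  have s: "u \<le> s" using assms by (simp add: s_def)
  have "real K * \<theta> = real K * \<rho> + real K * u" by (simp add: u_def algebra_simps)
  moreover have "1 * u \<le> real K * u" using assms u by (intro mult_right_mono) auto
  ultimately have sK: "s \<le> real K * \<theta>" by (simp add: s_def)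
  have D: "density_gap K \<theta> \<rho> = u ^ 3 / s\<^sup>2" by (simp add: density_gap_def u_def s_def)
  show "0 < density_gap K \<theta> \<rho>" using u s by (simp add: D)
  have "u ^ 3 / s\<^sup>2 \<le> u ^ 3 / u\<^sup>2" using u s by (intro divide_left_mono power_mono) auto
  also have "\<dots> = u" using u by (simp add: power2_eq_square power3_eq_cube)
  finally show "density_gap K \<theta> \<rho> \<le> \<theta>" using u D by simp
  have "u ^ 3 / (real K * \<theta>)\<^sup>2 \<le> u ^ 3 / s\<^sup>2"
    using u s sK assms by (intro divide_left_mono power_mono) auto
  thus "(\<theta> - \<rho>) ^ 3 / ((real K)\<^sup>2 * \<theta>\<^sup>2) \<le> density_gap K \<theta> \<rho>"
    by (simp add: D power_mult_distrib flip: u_def)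
qed

text \<open>Common reduction for both algorithms: it remains to check the noise rates and the
  accuracy of \<open>S\<close> on accurate graphs. The threshold involves only \<open>n\<close>,
  \<open>K\<close>, \<open>\<theta>\<close> and \<open>\<rho>\<close>, hence works for every
  labelling.\<close>

lemma consistent_exact_recoveryI:
  fixes S :: "nat \<Rightarrow> (nat \<Rightarrow> nat \<Rightarrow> real) \<Rightarrow> nat \<Rightarrow> nat \<Rightarrow> real" and C :: real
  assumes K: "K \<ge> 1" and C: "C \<ge> 1"
    and params: "\<And>n. n \<ge> 1 \<Longrightarrow> 0 < \<rho> n \<and> \<rho> n < \<theta> n \<and> \<theta> n \<le> 1 / 2 \<and> \<theta> n \<le> C * \<rho> n"
    and \<eta>: "\<And>n. \<eta> n = density_gap K (\<theta> n) (\<rho> n) / (6000 * real K ^ 3 * C)"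
    and rate1: "\<forall>\<^sub>F n in sequentially. 384 * \<theta> n * ln (real n) \<le> (\<eta> n)\<^sup>2 * real n"
    and rate2: "\<forall>\<^sub>F n in sequentially. 96 * (real K)\<^sup>2 * ln (real n) \<le> (\<eta> n)\<^sup>2 * (real n)\<^sup>2 * \<theta> n"
    and S: "\<forall>\<^sub>F n in sequentially. \<forall>z x i j. sbm_graph n K (\<theta> n) (\<rho> n) (\<eta> n) z x \<longrightarrow>
        i < n * K \<longrightarrow> j < n * K \<longrightarrow>
        \<bar>S (n * K) (adj x) i j - pair_density K (\<theta> n) (\<rho> n) (z i = z j) * Ncount (n * K) (adj x) i j\<bar>
          \<le> 10 * ((real K)\<^sup>2 * (\<eta> n * (real n * \<theta> n)\<^sup>2))"
  shows "consistent_exact_recovery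
           (\<lambda>m Y lam i j. of_bool (T_stat m Y (S m Y) i j \<le> lam)) K \<theta> \<rho>"
proof -
  define lam where "lam = (\<lambda>n. (real n)\<^sup>2 * \<theta> n * (density_gap K (\<theta> n) (\<rho> n))\<^sup>2 / 400)"
  \<comment> \<open>Needed to obtain \<open>2 * K \<le> \<eta> * n\<close> from the first
    rate.\<close>
  have large: "\<forall>\<^sub>F n in sequentially. real K \<le> ln (real n)"
    by (rule eventually_compose_filterlim[OF _ filterlim_compose[OF ln_at_top filterlim_real_sequentially]])
       (rule eventually_ge_at_top)
  show ?thesis
    unfolding consistent_exact_recovery_def
  proof (intro exI[of _ lam] allI impI)
    fix z :: "nat \<Rightarrow> nat \<Rightarrow> nat"
    assume bal: "\<forall>n. balanced_communities n K (z n)"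
    define G where "G = (\<lambda>n. {Y. \<forall>i<n * K. \<forall>j<n * K.
        of_bool (T_stat (n * K) Y (S (n * K) Y) i j \<le> lam n) = Wstar (z n) i j})"
    have ev: "\<forall>\<^sub>F n in sequentially. 1 - 4 * (real K)\<^sup>2 / real n \<le>
        measure_pmf.prob (SBM n K (z n) (\<theta> n) (\<rho> n)) (G n)"
      using rate1 rate2 S large eventually_ge_at_top[of 1]
    proof eventually_elim
      case (elim n)
      note par = params[OF elim(5)]
      have \<theta>: "0 < \<theta> n" using par by linarith
      note \<eta>_n = \<eta>[of n]
      note gap = density_gap_bounds[OF K, of "\<rho> n" "\<theta> n"]
      have Kpos: "1 \<le> real K" using K by simp
      have K3: "1 * 1 \<le> real K ^ 3 * C" using Kpos C by (intro mult_mono one_le_power) auto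
      have \<eta>0: "0 < \<eta> n" using gap par K3 Kpos C by (simp add: \<eta>)
      have "6 * (real K)\<^sup>2 * \<eta> n = density_gap K (\<theta> n) (\<rho> n) / (1000 * (real K * C))"
        using Kpos C by (simp add: \<eta> power2_eq_square power3_eq_cube)
      also have "\<dots> \<le> \<theta> n / 1"
      proof (rule frac_le)
        have "1 * 1 \<le> real K * C" using Kpos C by (intro mult_mono) auto
        thus "1 \<le> 1000 * (real K * C)" by linarith
      qed (use gap par \<theta> in auto)
      finally have \<eta>1: "6 * (real K)\<^sup>2 * \<eta> n \<le> \<theta> n" by simp
      have "1 \<le> 6 * (real K)\<^sup>2" using one_le_power[OF Kpos, of 2] by linarith
      hence "1 * \<eta> n \<le> 6 * (real K)\<^sup>2 * \<eta> n" using \<eta>0 by (intro mult_right_mono) auto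
      hence "\<eta> n \<le> \<theta> n" using \<eta>1 by linarith
      \<comment> \<open>One factor \<open>\<eta>\<close> in the first rate is replaced by
        \<open>\<theta>\<close>, which then cancels.\<close>
      hence "\<eta> n * (\<eta> n * real n) \<le> \<theta> n * (\<eta> n * real n)" using \<eta>0 by (intro mult_right_mono) auto
      hence "\<theta> n * (384 * ln (real n)) \<le> \<theta> n * (\<eta> n * real n)"
        using elim(1) by (simp add: power2_eq_square mult_ac)
      hence "384 * ln (real n) \<le> \<eta> n * real n" using \<theta> by simp
      hence \<eta>2: "2 * real K \<le> \<eta> n * real n" using elim(4) Kpos by linarith
      have "{x. sbm_graph n K (\<theta> n) (\<rho> n) (\<eta> n) (z n) x} \<subseteq> adj -` G n"
      proof safe
        fix x assume sbm: "sbm_graph n K (\<theta> n) (\<rho> n) (\<eta> n) (z n) x"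
        interpret sbm_graph n K "\<theta> n" "\<rho> n" "\<eta> n" "z n" x by (rule sbm)
        have "of_bool (T_stat (n * K) (adj x) (S (n * K) (adj x)) i j \<le> lam n) = Wstar (z n) i j"
          if "i < n * K" "j < n * K" for i j
          unfolding lam_def using elim(3) sbm C par \<eta>_n
          by (intro recovers[OF that, where C = C]) auto
        thus "x \<in> adj -` G n" by (simp add: G_def)
      qed
      hence "measure_pmf.prob (edge_pmf (edges (n * K)) (z n) (\<theta> n) (\<rho> n))
          {x. sbm_graph n K (\<theta> n) (\<rho> n) (\<eta> n) (z n) x} \<le>
        measure_pmf.prob (SBM n K (z n) (\<theta> n) (\<rho> n)) (G n)"
        unfolding SBM_adj measure_map_pmf by (intro measure_pmf.finite_measure_mono) auto
      moreover have "1 - 4 * (real K)\<^sup>2 / real n \<le>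
          measure_pmf.prob (edge_pmf (edges (n * K)) (z n) (\<theta> n) (\<rho> n))
            {x. sbm_graph n K (\<theta> n) (\<rho> n) (\<eta> n) (z n) x}"
        using bal K elim par \<eta>0 \<eta>1 \<eta>2 by (intro prob_sbm_graph_ge) auto
      ultimately show ?case by linarith
    qed
    have lim: "(\<lambda>n. 1 - 4 * (real K)\<^sup>2 / real n) \<longlonglongrightarrow> 1 - 0"
      by (intro tendsto_diff tendsto_const lim_const_over_n)
    have "(\<lambda>n. measure_pmf.prob (SBM n K (z n) (\<theta> n) (\<rho> n)) (G n)) \<longlonglongrightarrow> 1"
      by (rule tendsto_sandwich[OF ev _ _ tendsto_const]) (use lim in auto)
    thus "(\<lambda>n. measure_pmf.prob (SBM n K (z n) (\<theta> n) (\<rho> n))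
        {Y. \<forall>i<n * K. \<forall>j<n * K.
          of_bool (T_stat (n * K) Y (S (n * K) Y) i j \<le> lam n) = Wstar (z n) i j}) \<longlonglongrightarrow> 1"
      by (simp only: G_def)
  qed
qed

section \<open>Rates\<close>

text \<open>Clears the fractional exponents of the separation conditions. The value
  \<open>x = 0\<close> is included because \<open>ln 1 = 0\<close>.\<close>

lemma powr_powr_power:
  fixes x :: real
  assumes "0 \<le> x" "k \<noteq> 0" "real k * a = b"
  shows "(x powr a) ^ k = x powr b"
  using assms by (cases "x = 0") (auto simp: powr_power)

lemma eventually_ln_le_powr:
  assumes "0 < a" "0 < s"
  shows "\<forall>\<^sub>F n in sequentially. ln (real n) \<le> a * real n powr s"
proof -
  have "\<forall>\<^sub>F n in sequentially. ln (real n) / real n powr s < a"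
    using order_tendstoD(2)[OF lim_ln_over_power[OF assms(2)] assms(1)] .
  thus ?thesis using eventually_gt_at_top[of 0]
    by eventually_elim (simp add: divide_less_eq)
qed

text \<open>For the original statistic the sampling rate follows from the composition and bias
  rates. If \<open>n * \<theta>^2 \<ge> 1\<close>, multiply the composition rate by
  \<open>n * \<theta>\<close>. Otherwise \<open>L \<le> sqrt n\<close> gives
  \<open>L * \<theta> \<le> 1\<close>, and the squared bias rate suffices.\<close>

lemma rate_interpolation:
  fixes D \<theta> n L B :: real
  assumes \<theta>: "0 < \<theta>" and n: "1 \<le> n" and L: "0 \<le> L" "L \<le> sqrt n" and B: "0 \<le> B"
    and r1: "B\<^sup>2 * \<theta> * L \<le> D\<^sup>2 * n" and r3: "B \<le> D * (n * \<theta>)"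
  shows "B\<^sup>2 * L \<le> D\<^sup>2 * n\<^sup>2 * \<theta>"
proof (cases "1 \<le> n * \<theta>\<^sup>2")
  case True
  have "B\<^sup>2 * L * 1 \<le> B\<^sup>2 * L * (n * \<theta>\<^sup>2)" using True L by (intro mult_left_mono) auto
  also have "\<dots> = (B\<^sup>2 * \<theta> * L) * (n * \<theta>)" by (simp add: power2_eq_square)
  also have "\<dots> \<le> (D\<^sup>2 * n) * (n * \<theta>)" using r1 \<theta> n by (intro mult_right_mono) auto
  finally show ?thesis by (simp add: power2_eq_square mult_ac)
next
  case False
  have "(L * \<theta>)\<^sup>2 \<le> (sqrt n * \<theta>)\<^sup>2" using L \<theta> by (intro power_mono mult_right_mono) auto
  also have "\<dots> = n * \<theta>\<^sup>2" using n by (simp add: power_mult_distrib)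
  also have "\<dots> \<le> 1\<^sup>2" using False by simp
  finally have "L * \<theta> \<le> 1" by (rule power2_le_imp_le) simp
  hence "B\<^sup>2 * (L * \<theta>) \<le> B\<^sup>2 * 1" by (intro mult_left_mono) auto
  also have "\<dots> \<le> (D * (n * \<theta>))\<^sup>2" using r3 B by (simp add: power_mono)
  also have "\<dots> = (D\<^sup>2 * n\<^sup>2 * \<theta>) * \<theta>" by (simp add: power2_eq_square)
  finally have "B\<^sup>2 * L * \<theta> \<le> (D\<^sup>2 * n\<^sup>2 * \<theta>) * \<theta>" by (simp add: mult.assoc)
  thus ?thesis using \<theta> by simp
qed

text \<open>The second factor converts \<open>D\<close> to \<open>\<eta>\<close>; the square
  \<open>400 * K^2\<close> of the first dominates the constants 384 and \<open>96 * K^2\<close> of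
  the two rates.\<close>

definition rate_const :: "nat \<Rightarrow> real \<Rightarrow> real" where
  "rate_const K C = 20 * real K * (6000 * real K ^ 3 * C)"

lemma rate_const_scale:
  fixes D y :: real
  assumes K: "K \<ge> 1" and C: "C \<ge> 1"
    and \<eta>: "\<eta> = D / (6000 * real K ^ 3 * C)"
  shows "(rate_const K C)\<^sup>2 * y \<le> D\<^sup>2 * w \<Longrightarrow> 400 * (real K)\<^sup>2 * y \<le> \<eta>\<^sup>2 * w"
    and "rate_const K C \<le> D * w \<Longrightarrow> 2 \<le> \<eta> * w"
proof -
  define k where "k = 6000 * real K ^ 3 * C"
  have Kpos: "1 \<le> real K" using K by simp
  have k: "0 < k" using K C by (simp add: k_def)
  have k\<eta>: "D = k * \<eta>" "rate_const K C = k * (20 * real K)"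
    using k by (simp_all add: \<eta> rate_const_def flip: k_def)
  show "400 * (real K)\<^sup>2 * y \<le> \<eta>\<^sup>2 * w" if "(rate_const K C)\<^sup>2 * y \<le> D\<^sup>2 * w"
  proof -
    have "k\<^sup>2 * (400 * (real K)\<^sup>2 * y) \<le> k\<^sup>2 * (\<eta>\<^sup>2 * w)"
      using that unfolding k\<eta> by (simp add: power_mult_distrib mult.assoc)
    thus ?thesis using k by simp
  qed
  assume "rate_const K C \<le> D * w"
  hence "k * (20 * real K) \<le> k * (\<eta> * w)" unfolding k\<eta> by (simp add: mult.assoc)
  hence "20 * real K \<le> \<eta> * w" using k by simp
  thus "2 \<le> \<eta> * w" using Kpos by linarith
qed

text \<open>Restates consistency as rates for the gap. Both algorithms need the composition rate;
  the corrected one adds the sampling rate, the original one the bias rate, from which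
  \<open>rate_interpolation\<close> recovers sampling.\<close>

lemma
  fixes C :: real
  assumes K: "K \<ge> 1" and C: "C \<ge> 1"
    and params: "\<And>n. n \<ge> 1 \<Longrightarrow> 0 < \<rho> n \<and> \<rho> n < \<theta> n \<and> \<theta> n \<le> 1 / 2 \<and> \<theta> n \<le> C * \<rho> n"
    and rate1: "\<forall>\<^sub>F n in sequentially.
        (rate_const K C)\<^sup>2 * \<theta> n * ln (real n) \<le> (density_gap K (\<theta> n) (\<rho> n))\<^sup>2 * real n"
  shows AWCD1_consistentI:
    "\<forall>\<^sub>F n in sequentially. (rate_const K C)\<^sup>2 * ln (real n) \<le>
        (density_gap K (\<theta> n) (\<rho> n))\<^sup>2 * (real n)\<^sup>2 * \<theta> n \<Longrightarrow>
     consistent_exact_recovery AWCD1 K \<theta> \<rho>"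
  and AWCD1_orig_consistentI:
    "\<forall>\<^sub>F n in sequentially. rate_const K C \<le> density_gap K (\<theta> n) (\<rho> n) * (real n * \<theta> n) \<Longrightarrow>
     consistent_exact_recovery AWCD1_orig K \<theta> \<rho>"
proof -
  define \<eta> where "\<eta> = (\<lambda>n. density_gap K (\<theta> n) (\<rho> n) / (6000 * real K ^ 3 * C))"
  have Kpos: "1 \<le> real K" using K by simp
  have K2: "1 \<le> (real K)\<^sup>2" using one_le_power[OF Kpos] .
  have r1: "\<forall>\<^sub>F n in sequentially. 384 * \<theta> n * ln (real n) \<le> (\<eta> n)\<^sup>2 * real n"
    using rate1 eventually_ge_at_top[of 1]
  proof eventually_elim
    case (elim n)
    have "0 \<le> \<theta> n * ln (real n)" using params[OF elim(2)] elim(2) by simp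
    hence "384 * (\<theta> n * ln (real n)) \<le> 400 * (real K)\<^sup>2 * (\<theta> n * ln (real n))"
      using K2 by (intro mult_right_mono) auto
    also have "\<dots> \<le> (\<eta> n)\<^sup>2 * real n"
      using elim(1) by (intro rate_const_scale(1)[OF K C]) (auto simp: \<eta>_def mult.assoc)
    finally show ?case by (simp add: mult.assoc)
  qed
  have r2: "\<forall>\<^sub>F n in sequentially. 96 * (real K)\<^sup>2 * ln (real n) \<le> (\<eta> n)\<^sup>2 * (real n)\<^sup>2 * \<theta> n"
    if "\<forall>\<^sub>F n in sequentially. (rate_const K C)\<^sup>2 * ln (real n) \<le>
        (density_gap K (\<theta> n) (\<rho> n))\<^sup>2 * (real n)\<^sup>2 * \<theta> n"
    using that eventually_ge_at_top[of 1]
  proof eventually_elim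
    case (elim n)
    have "96 * (real K)\<^sup>2 * ln (real n) \<le> 400 * (real K)\<^sup>2 * ln (real n)"
      using elim(2) by (intro mult_right_mono) auto
    also have "\<dots> \<le> (\<eta> n)\<^sup>2 * ((real n)\<^sup>2 * \<theta> n)"
      using elim(1) by (intro rate_const_scale(1)[OF K C]) (auto simp: \<eta>_def mult.assoc)
    finally show ?case by (simp add: mult.assoc)
  qed
  show "consistent_exact_recovery AWCD1 K \<theta> \<rho>"
    if "\<forall>\<^sub>F n in sequentially. (rate_const K C)\<^sup>2 * ln (real n) \<le>
        (density_gap K (\<theta> n) (\<rho> n))\<^sup>2 * (real n)\<^sup>2 * \<theta> n"
  proof -
    have "consistent_exact_recovery (\<lambda>m Y lam i j. of_bool (T_stat m Y (S_corr m Y) i j \<le> lam)) K \<theta> \<rho>"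
      by (intro consistent_exact_recoveryI[OF K C params \<eta>_def[THEN fun_cong] r1 r2[OF that]]
          always_eventually allI impI) (assumption | rule sbm_graph.S_corr_Ncount)+
    thus ?thesis by (simp add: AWCD1_def[abs_def])
  qed
  assume r3: "\<forall>\<^sub>F n in sequentially. rate_const K C \<le> density_gap K (\<theta> n) (\<rho> n) * (real n * \<theta> n)"
  have ln_le: "\<forall>\<^sub>F n in sequentially. ln (real n) \<le> 1 * real n powr (1 / 2)"
    by (rule eventually_ln_le_powr) auto
  have "\<forall>\<^sub>F n in sequentially. (rate_const K C)\<^sup>2 * ln (real n) \<le>
      (density_gap K (\<theta> n) (\<rho> n))\<^sup>2 * (real n)\<^sup>2 * \<theta> n"
    using rate1 r3 eventually_ge_at_top[of 1] ln_le
  proof eventually_elim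
    case (elim n)
    thus ?case
      using params[OF elim(3)] C
      by (intro rate_interpolation) (auto simp: rate_const_def powr_half_sqrt)
  qed
  note r2' = r2[OF this]
  have "\<forall>\<^sub>F n in sequentially. 2 \<le> \<eta> n * (real n * \<theta> n)"
    using r3 by eventually_elim (intro rate_const_scale(2)[OF K C], auto simp: \<eta>_def)
  hence "\<forall>\<^sub>F n in sequentially. \<forall>z x i j. sbm_graph n K (\<theta> n) (\<rho> n) (\<eta> n) z x \<longrightarrow>
        i < n * K \<longrightarrow> j < n * K \<longrightarrow>
        \<bar>S_orig (n * K) (adj x) i j - pair_density K (\<theta> n) (\<rho> n) (z i = z j) * Ncount (n * K) (adj x) i j\<bar>
          \<le> 10 * ((real K)\<^sup>2 * (\<eta> n * (real n * \<theta> n)\<^sup>2))"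
    by eventually_elim (intro allI impI sbm_graph.S_orig_Ncount)
  hence "consistent_exact_recovery (\<lambda>m Y lam i j. of_bool (T_stat m Y (S_orig m Y) i j \<le> lam)) K \<theta> \<rho>"
    by (intro consistent_exact_recoveryI[OF K C params \<eta>_def[THEN fun_cong] r1 r2'])
  thus "consistent_exact_recovery AWCD1_orig K \<theta> \<rho>" by (simp add: AWCD1_orig_def[abs_def])
qed

text \<open>Here \<open>u = \<theta> - \<rho>\<close>, \<open>k = K\<^sup>2\<close>, \<open>L = log n\<close>, and the premises are the separation conditions of
  part (2) raised to the power 3 or 6.\<close>

lemma
  fixes u k \<theta> D :: real
  assumes "0 < u" "0 < \<theta>" "0 < k" "0 < c" and D: "u ^ 3 \<le> k * \<theta>\<^sup>2 * D"
    and n: "0 < n" and B: "0 \<le> B" "c ^ 3 * k * B \<le> 1" and L: "0 \<le> L"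
  shows gap_from_bias: "\<theta> \<le> (c * u) ^ 3 * n \<Longrightarrow> B \<le> D * (n * \<theta>)"
    and gap_from_composition: "\<theta> ^ 5 * L \<le> (c * u) ^ 6 * n \<Longrightarrow> B\<^sup>2 * \<theta> * L \<le> D\<^sup>2 * n"
    and gap_from_sampling: "\<theta> ^ 3 * L \<le> (c * u) ^ 6 * n\<^sup>2 \<Longrightarrow> B\<^sup>2 * L \<le> D\<^sup>2 * n\<^sup>2 * \<theta>"
proof -
  have "0 < k * \<theta>\<^sup>2 * D" using D assms(1) by (meson less_le_trans zero_less_power)
  moreover have "0 < k * \<theta>\<^sup>2" using assms by simp
  ultimately have D0: "0 < D" by (rule zero_less_mult_pos)
  \<comment> \<open>Powers of the separation \<open>c * u\<close> are converted into powers of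
    \<open>D\<close> at the cost of \<open>c^3 * k\<close>; smallness of \<open>c^3 * k * B\<close>
    then buys the factor \<open>B\<close>.\<close>
  have cu3: "(c * u) ^ 3 \<le> c ^ 3 * (k * \<theta>\<^sup>2 * D)"
    using D assms by (simp add: power_mult_distrib)
  have "((c * u) ^ 3)\<^sup>2 \<le> (c ^ 3 * (k * \<theta>\<^sup>2 * D))\<^sup>2"
    using cu3 assms by (intro power_mono) auto
  hence cu6: "(c * u) ^ 6 \<le> (c ^ 3 * k)\<^sup>2 * \<theta> ^ 4 * D\<^sup>2"
    by (simp add: power_mult_distrib mult_ac flip: power_mult)
  have "(c ^ 3 * k * B)\<^sup>2 \<le> 1\<^sup>2" using B assms by (intro power_mono) auto
  hence B2: "(c ^ 3 * k)\<^sup>2 * B\<^sup>2 \<le> 1" by (simp add: power_mult_distrib)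
  show "B \<le> D * (n * \<theta>)" if "\<theta> \<le> (c * u) ^ 3 * n"
  proof -
    have "\<theta> * 1 \<le> c ^ 3 * (k * \<theta>\<^sup>2 * D) * n"
      using that mult_right_mono[OF cu3 less_imp_le[OF n]] by linarith
    also have "\<dots> = \<theta> * (c ^ 3 * k * (D * (n * \<theta>)))" by (simp add: power2_eq_square)
    finally have "1 \<le> c ^ 3 * k * (D * (n * \<theta>))" using assms by simp
    hence "B * 1 \<le> B * (c ^ 3 * k * (D * (n * \<theta>)))" using B by (intro mult_left_mono) auto
    also have "\<dots> = (c ^ 3 * k * B) * (D * (n * \<theta>))" by simp
    also have "\<dots> \<le> 1 * (D * (n * \<theta>))" using B D0 n assms by (intro mult_right_mono) auto
    finally show ?thesis by simp
  qed
  show "B\<^sup>2 * \<theta> * L \<le> D\<^sup>2 * n" if "\<theta> ^ 5 * L \<le> (c * u) ^ 6 * n"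
  proof -
    have "\<theta> ^ 4 * (\<theta> * L) = \<theta> ^ 5 * L" by (simp add: power_numeral_reduce)
    also have "\<dots> \<le> (c ^ 3 * k)\<^sup>2 * \<theta> ^ 4 * D\<^sup>2 * n"
      using that mult_right_mono[OF cu6 less_imp_le[OF n]] by linarith
    also have "\<dots> = \<theta> ^ 4 * ((c ^ 3 * k)\<^sup>2 * (D\<^sup>2 * n))" by simp
    finally have "\<theta> * L \<le> (c ^ 3 * k)\<^sup>2 * (D\<^sup>2 * n)" using assms(2) by simp
    hence "B\<^sup>2 * (\<theta> * L) \<le> B\<^sup>2 * ((c ^ 3 * k)\<^sup>2 * (D\<^sup>2 * n))" by (intro mult_left_mono) auto
    also have "\<dots> = ((c ^ 3 * k)\<^sup>2 * B\<^sup>2) * (D\<^sup>2 * n)" by simp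
    also have "\<dots> \<le> 1 * (D\<^sup>2 * n)" using B2 n by (intro mult_right_mono) auto
    finally show ?thesis by (simp add: mult.assoc)
  qed
  show "B\<^sup>2 * L \<le> D\<^sup>2 * n\<^sup>2 * \<theta>" if "\<theta> ^ 3 * L \<le> (c * u) ^ 6 * n\<^sup>2"
  proof -
    have "\<theta> ^ 3 * L \<le> (c ^ 3 * k)\<^sup>2 * \<theta> ^ 4 * D\<^sup>2 * n\<^sup>2"
      using that mult_right_mono[OF cu6 zero_le_power2[of n]] by linarith
    also have "\<dots> = \<theta> ^ 3 * ((c ^ 3 * k)\<^sup>2 * (D\<^sup>2 * n\<^sup>2 * \<theta>))" by (simp add: power_numeral_reduce)
    finally have "L \<le> (c ^ 3 * k)\<^sup>2 * (D\<^sup>2 * n\<^sup>2 * \<theta>)" using assms(2) by simp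
    hence "B\<^sup>2 * L \<le> B\<^sup>2 * ((c ^ 3 * k)\<^sup>2 * (D\<^sup>2 * n\<^sup>2 * \<theta>))" by (intro mult_left_mono) auto
    also have "\<dots> = ((c ^ 3 * k)\<^sup>2 * B\<^sup>2) * (D\<^sup>2 * n\<^sup>2 * \<theta>)" by simp
    also have "\<dots> \<le> 1 * (D\<^sup>2 * n\<^sup>2 * \<theta>)" using B2 n assms(2) by (intro mult_right_mono) auto
    finally show ?thesis by simp
  qed
qed

section \<open>Choice of the constant and the four regimes\<close>

theorem theorem1:
  fixes K :: nat and C :: real
  assumes "K \<ge> 2" and "C > 1"
  shows "\<exists>c::real. c > 0 \<and>
    (\<forall>\<theta> \<rho> :: nat \<Rightarrow> real.
      (\<forall>n\<ge>1. 0 < \<rho> n \<and> \<rho> n < \<theta> n \<and> \<theta> n \<le> 1 / 2) \<longrightarrow>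
      ((\<forall>n\<ge>1. \<theta> n / \<rho> n = C) \<longrightarrow>
        ((\<forall>\<^sub>F n in sequentially. c * \<theta> n > real n powr (- 1 / 2)) \<longrightarrow>
          consistent_exact_recovery AWCD1_orig K \<theta> \<rho>) \<and>
        ((\<forall>\<^sub>F n in sequentially.
            c * \<theta> n > real n powr (- 2 / 3) * ln (real n) powr (1 / 3)) \<longrightarrow>
          consistent_exact_recovery AWCD1 K \<theta> \<rho>)) \<and>
      ((\<forall>n\<ge>1. \<theta> n / \<rho> n \<le> C) \<longrightarrow>
        ((\<forall>\<^sub>F n in sequentially.
            c * (\<theta> n - \<rho> n) >
              max (real n powr (- 1 / 3) * \<theta> n powr (1 / 3))
                  (real n powr (- 1 / 6) * \<theta> n powr (5 / 6) * ln (real n) powr (1 / 6))) \<longrightarrow>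
          consistent_exact_recovery AWCD1_orig K \<theta> \<rho>) \<and>
        ((\<forall>\<^sub>F n in sequentially.
            c * (\<theta> n - \<rho> n) >
              max (real n powr (- 1 / 3) * \<theta> n powr (1 / 2) * ln (real n) powr (1 / 6))
                  (real n powr (- 1 / 6) * \<theta> n powr (5 / 6) * ln (real n) powr (1 / 6))) \<longrightarrow>
          consistent_exact_recovery AWCD1 K \<theta> \<rho>)))"
proof -
  define B where "B = rate_const K C"
  define k where "k = (real K)\<^sup>2"
  \<comment> \<open>If \<open>\<theta> / \<rho> = C\<close>, then
    \<open>\<theta> - \<rho> = (1 - 1 / C) * \<theta>\<close>, so the gap is at least
    \<open>\<kappa> * \<theta>\<close>.\<close>
  define \<kappa> where "\<kappa> = (1 - 1 / C) ^ 3 / k"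
  \<comment> \<open>Chosen so that \<open>c * k * B^2 = \<kappa>^2\<close>. As \<open>c\<close> and
    \<open>\<kappa>\<close> are at most 1 and \<open>k\<close> and \<open>B\<close> at least 1, this
    implies all smallness conditions: \<open>c2\<close> and \<open>c3'\<close> for part (1),
    \<open>c3\<close> for part (2).\<close>
  define c where "c = \<kappa>\<^sup>2 / (k * B\<^sup>2)"
  have K1: "K \<ge> 1" and C1: "C \<ge> 1" and Kpos: "1 \<le> real K" using assms by auto
  have k1: "1 \<le> k" using one_le_power[OF Kpos] by (simp add: k_def)
  have "1 * (1 * 1) \<le> 20 * real K * (6000 * real K ^ 3 * C)"
  proof (intro mult_mono)
    show "1 \<le> 6000 * real K ^ 3" using one_le_power[OF Kpos, of 3] by linarith
  qed (use Kpos C1 in auto)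
  hence B1: "1 \<le> B" by (simp add: B_def rate_const_def)
  have "0 < (1 - 1 / C) ^ 3" "(1 - 1 / C) ^ 3 \<le> 1" using assms by (auto intro!: power_le_one)
  hence \<kappa>: "0 < \<kappa>" "\<kappa> \<le> 1" using k1 by (auto simp: \<kappa>_def divide_le_eq)
  have \<kappa>2: "\<kappa>\<^sup>2 \<le> \<kappa>" "\<kappa>\<^sup>2 \<le> 1" using \<kappa> by (auto simp: power2_eq_square mult_le_one mult_left_le)
  have c0: "0 < c" using \<kappa> k1 B1 by (simp add: c_def)
  have ckB: "c * k * B\<^sup>2 = \<kappa>\<^sup>2" using k1 B1 by (simp add: c_def)
  have BB: "B \<le> B\<^sup>2" using B1 by (simp add: power2_eq_square)
  have ckB': "c * k * B \<le> \<kappa>\<^sup>2"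
    using mult_left_mono[OF BB, of "c * k"] c0 k1 unfolding ckB by simp
  have cB': "c * B\<^sup>2 \<le> \<kappa>\<^sup>2"
    using mult_right_mono[OF k1, of "c * B\<^sup>2"] c0 unfolding ckB[symmetric] by (simp add: mult_ac)
  have "1 \<le> B\<^sup>2" using B1 BB by linarith
  hence "c * 1 \<le> c * B\<^sup>2" using c0 by (intro mult_left_mono) auto
  hence c1: "c \<le> 1" using cB' \<kappa>2 by linarith
  have c_pow: "c ^ 3 \<le> c" "c\<^sup>2 \<le> c" using c0 c1 power_decreasing[of 1 3 c] power_decreasing[of 1 2 c] by auto
  have "c ^ 3 * (k * B) \<le> c * (k * B)" using c_pow k1 B1 by (intro mult_right_mono) auto
  hence c3: "c ^ 3 * k * B \<le> 1" using ckB' \<kappa>2 by (simp add: mult.assoc)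
  have c2: "c\<^sup>2 * B \<le> \<kappa>"
  proof -
    have "c\<^sup>2 * B \<le> c * B\<^sup>2" using c_pow BB c0 B1 by (intro mult_mono) auto
    thus ?thesis using cB' \<kappa>2 by linarith
  qed
  have c3': "c ^ 3 * B\<^sup>2 \<le> \<kappa>\<^sup>2"
    using mult_right_mono[OF c_pow(1), of "B\<^sup>2"] cB' by simp
  show ?thesis
  proof (intro exI[of _ c] conjI allI impI c0)
    fix \<theta> \<rho> :: "nat \<Rightarrow> real"
    assume par: "\<forall>n\<ge>1. 0 < \<rho> n \<and> \<rho> n < \<theta> n \<and> \<theta> n \<le> 1 / 2"
    define D where "D = (\<lambda>n. density_gap K (\<theta> n) (\<rho> n))"
    have D0: "0 < D n" and u3: "(\<theta> n - \<rho> n) ^ 3 \<le> k * (\<theta> n)\<^sup>2 * D n" if "n \<ge> 1" for n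
    proof -
      note gap = density_gap_bounds[OF K1, of "\<rho> n" "\<theta> n"]
      show "0 < D n" using gap(1) par that by (simp add: D_def)
      have "\<theta> n > 0" using par that by fastforce
      hence "0 < k * (\<theta> n)\<^sup>2" using k1 by simp
      moreover have "(\<theta> n - \<rho> n) ^ 3 / (k * (\<theta> n)\<^sup>2) \<le> D n"
        using gap(3) par that by (simp add: D_def k_def)
      ultimately show "(\<theta> n - \<rho> n) ^ 3 \<le> k * (\<theta> n)\<^sup>2 * D n"
        by (simp add: pos_divide_le_eq mult.commute)
    qed
    have D_ratio: "\<kappa> * \<theta> n \<le> D n" if "\<theta> n / \<rho> n = C" "n \<ge> 1" for n
    proof -
      have pos: "0 < \<theta> n" "0 < \<rho> n" using par that(2) by fastforce+
      hence "\<rho> n = \<theta> n / C" using that(1) by (auto simp: field_simps)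
      hence "\<theta> n - \<rho> n = (1 - 1 / C) * \<theta> n" by (simp add: algebra_simps)
      hence "((1 - 1 / C) * \<theta> n) ^ 3 \<le> k * (\<theta> n)\<^sup>2 * D n" using u3[OF that(2)] by simp
      moreover have "((1 - 1 / C) * \<theta> n) ^ 3 = k * (\<theta> n)\<^sup>2 * (\<kappa> * \<theta> n)"
        using k1 by (simp add: \<kappa>_def power_mult_distrib power2_eq_square power3_eq_cube)
      ultimately have "k * (\<theta> n)\<^sup>2 * (\<kappa> * \<theta> n) \<le> k * (\<theta> n)\<^sup>2 * D n" by simp
      moreover have "0 < k * (\<theta> n)\<^sup>2" using k1 pos by simp
      ultimately show ?thesis by (rule mult_left_le_imp_le)
    qed
    have params: "0 < \<rho> n \<and> \<rho> n < \<theta> n \<and> \<theta> n \<le> 1 / 2 \<and> \<theta> n \<le> C * \<rho> n"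
      if "\<forall>n\<ge>1. \<theta> n / \<rho> n \<le> C" "n \<ge> 1" for n
    proof -
      have "0 < \<rho> n" "\<theta> n / \<rho> n \<le> C" using par that by auto
      thus ?thesis using par that(2) by (simp add: divide_le_eq)
    qed
    {
      assume ratio: "\<forall>n\<ge>1. \<theta> n / \<rho> n = C"
      hence ratio': "\<forall>n\<ge>1. \<theta> n / \<rho> n \<le> C" by auto
      \<comment> \<open>With \<open>D\<close> of order \<open>\<theta>\<close>, composition noise
        only requires \<open>n * \<theta>\<close> to exceed a multiple of
        \<open>ln n\<close>.\<close>
      have rate1: "B\<^sup>2 * \<theta> n * ln (real n) \<le> (D n)\<^sup>2 * real n"
        if n: "n \<ge> 1" and "ln (real n) \<le> \<kappa>\<^sup>2 / B\<^sup>2 * (real n * \<theta> n)" for n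
      proof -
        have \<theta>: "0 < \<theta> n" using par n by fastforce
        have "B\<^sup>2 * ln (real n) \<le> \<kappa>\<^sup>2 * (real n * \<theta> n)"
          using that(2) B1 by (simp add: le_divide_eq mult.commute)
        hence "\<theta> n * (B\<^sup>2 * ln (real n)) \<le> \<theta> n * (\<kappa>\<^sup>2 * (real n * \<theta> n))"
          using \<theta> by (intro mult_left_mono) auto
        also have "\<dots> = (\<kappa> * \<theta> n)\<^sup>2 * real n" by (simp add: power2_eq_square)
        also have "\<dots> \<le> (D n)\<^sup>2 * real n"
          using D_ratio n ratio \<kappa> \<theta> by (intro mult_right_mono power_mono) auto
        finally show ?thesis by (simp add: mult_ac)
      qed
      {
        assume sep: "\<forall>\<^sub>F n in sequentially. c * \<theta> n > real n powr (- 1 / 2)"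
        \<comment> \<open>Since \<open>c \<le> 1\<close>, the separation gives
          \<open>n * \<theta> \<ge> n powr (1 / 2)\<close>, which outgrows the logarithm.\<close>
        have ln1: "\<forall>\<^sub>F n in sequentially. ln (real n) \<le> \<kappa>\<^sup>2 / B\<^sup>2 * real n powr (1 / 2)"
          using \<kappa> B1 by (intro eventually_ln_le_powr) auto
        show "consistent_exact_recovery AWCD1_orig K \<theta> \<rho>"
        proof (rule AWCD1_orig_consistentI[OF K1 C1 params[OF ratio']])
          show "\<forall>\<^sub>F n in sequentially. (rate_const K C)\<^sup>2 * \<theta> n * ln (real n) \<le>
              (density_gap K (\<theta> n) (\<rho> n))\<^sup>2 * real n"
            using sep ln1 eventually_ge_at_top[of 1]
          proof eventually_elim
            case (elim n)
            have \<theta>: "0 < \<theta> n" using par elim(3) by fastforce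
            have "real n powr (1 / 2) = real n * real n powr (- 1 / 2)"
              using elim(3) by (simp add: powr_mult_base)
            also have "\<dots> \<le> real n * \<theta> n"
              using elim(1) mult_right_mono[OF c1 less_imp_le[OF \<theta>]]
              by (intro mult_left_mono, linarith) simp
            finally have "\<kappa>\<^sup>2 / B\<^sup>2 * real n powr (1 / 2) \<le> \<kappa>\<^sup>2 / B\<^sup>2 * (real n * \<theta> n)"
              by (intro mult_left_mono) auto
            hence "ln (real n) \<le> \<kappa>\<^sup>2 / B\<^sup>2 * (real n * \<theta> n)" using elim(2) by linarith
            from rate1[OF elim(3) this] show ?case by (simp add: B_def D_def)
          qed
          show "\<forall>\<^sub>F n in sequentially. rate_const K C \<le> density_gap K (\<theta> n) (\<rho> n) * (real n * \<theta> n)"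
            using sep eventually_ge_at_top[of 1]
          proof eventually_elim
            case (elim n)
            have \<theta>: "0 < \<theta> n" using par elim(2) by fastforce
            have n: "0 < real n" using elim(2) by simp
            \<comment> \<open>Squared, the separation bounds \<open>n * \<theta>^2\<close> below by
              \<open>1 / c^2\<close>; the bias rate follows from
              \<open>D * n * \<theta> \<ge> \<kappa> * n * \<theta>^2\<close>.\<close>
            have "(real n powr (- 1 / 2))\<^sup>2 \<le> (c * \<theta> n)\<^sup>2"
              using elim(1) by (intro power_mono) auto
            moreover have "(real n powr (- 1 / 2))\<^sup>2 = 1 / real n"
              using n by (subst powr_powr_power[where b = "-1"]) (auto simp: powr_minus_divide)
            ultimately have "1 / real n \<le> c\<^sup>2 * (\<theta> n)\<^sup>2"
              by (simp only: power_mult_distrib)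
            hence "1 \<le> c\<^sup>2 * (real n * (\<theta> n)\<^sup>2)"
              using n by (simp add: divide_le_eq mult_ac)
            hence "B * 1 \<le> B * (c\<^sup>2 * (real n * (\<theta> n)\<^sup>2))"
              using B1 by (intro mult_left_mono) auto
            also have "\<dots> = (c\<^sup>2 * B) * (real n * (\<theta> n)\<^sup>2)" by simp
            also have "\<dots> \<le> \<kappa> * (real n * (\<theta> n)\<^sup>2)" using c2 by (intro mult_right_mono) auto
            also have "\<dots> = \<kappa> * \<theta> n * (real n * \<theta> n)" by (simp add: power2_eq_square)
            also have "\<dots> \<le> D n * (real n * \<theta> n)"
              using D_ratio ratio elim(2) \<theta> by (intro mult_right_mono) auto
            finally show ?case by (simp add: B_def D_def)
          qed
        qed
      }
      {
        assume sep: "\<forall>\<^sub>F n in sequentially. c * \<theta> n > real n powr (- 2 / 3) * ln (real n) powr (1 / 3)"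
        have ln1: "\<forall>\<^sub>F n in sequentially. ln (real n) \<le> \<kappa>\<^sup>2 / B\<^sup>2 * real n powr (1 / 3)"
          using \<kappa> B1 by (intro eventually_ln_le_powr) auto
        show "consistent_exact_recovery AWCD1 K \<theta> \<rho>"
        proof (rule AWCD1_consistentI[OF K1 C1 params[OF ratio']])
          show "\<forall>\<^sub>F n in sequentially. (rate_const K C)\<^sup>2 * \<theta> n * ln (real n) \<le>
              (density_gap K (\<theta> n) (\<rho> n))\<^sup>2 * real n"
            using sep ln1 eventually_ge_at_top[of 3]
          proof eventually_elim
            case (elim n)
            have n: "1 \<le> n" using elim(3) by simp
            have \<theta>: "0 < \<theta> n" using par n by fastforce
            have "1 \<le> ln (real n)" using elim(3) exp_le by (subst ln_ge_iff) auto
            hence "1 \<le> ln (real n) powr (1 / 3)" by (intro ge_one_powr_ge_zero) auto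
            hence "real n powr (- 2 / 3) * 1 \<le> real n powr (- 2 / 3) * ln (real n) powr (1 / 3)"
              by (intro mult_left_mono) auto
            also have "\<dots> \<le> \<theta> n" using elim(1) mult_right_mono[OF c1 less_imp_le[OF \<theta>]] by linarith
            finally have "real n * real n powr (- 2 / 3) \<le> real n * \<theta> n" by (intro mult_left_mono) auto
            moreover have "real n powr (1 / 3) = real n * real n powr (- 2 / 3)"
              using n by (simp add: powr_mult_base)
            ultimately have "\<kappa>\<^sup>2 / B\<^sup>2 * real n powr (1 / 3) \<le> \<kappa>\<^sup>2 / B\<^sup>2 * (real n * \<theta> n)"
              by (intro mult_left_mono) auto
            hence "ln (real n) \<le> \<kappa>\<^sup>2 / B\<^sup>2 * (real n * \<theta> n)" using elim(2) by linarith
            from rate1[OF n this] show ?case by (simp add: B_def D_def)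
          qed
          show "\<forall>\<^sub>F n in sequentially. (rate_const K C)\<^sup>2 * ln (real n) \<le>
              (density_gap K (\<theta> n) (\<rho> n))\<^sup>2 * (real n)\<^sup>2 * \<theta> n"
            using sep eventually_ge_at_top[of 1]
          proof eventually_elim
            case (elim n)
            have \<theta>: "0 < \<theta> n" using par elim(2) by fastforce
            have n: "0 < real n" using elim(2) by simp
            \<comment> \<open>The cube gives \<open>ln n \<le> c^3 * \<theta>^3 * n^2\<close>, which
              is the sampling rate up to constants when \<open>D\<close> is of order
              \<open>\<theta>\<close>.\<close>
            have "(real n powr (- 2 / 3) * ln (real n) powr (1 / 3)) ^ 3 \<le> (c * \<theta> n) ^ 3"
              using elim(1) by (intro power_mono) auto
            moreover have "(real n powr (- 2 / 3)) ^ 3 = 1 / (real n)\<^sup>2"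
              using n by (subst powr_powr_power[where b = "-2"]) (auto simp: powr_minus_divide powr_numeral)
            moreover have "(ln (real n) powr (1 / 3)) ^ 3 = ln (real n)"
              using elim(2) by (subst powr_powr_power[where b = 1]) auto
            ultimately have "ln (real n) / (real n)\<^sup>2 \<le> c ^ 3 * \<theta> n ^ 3"
              by (simp add: power_mult_distrib)
            hence "ln (real n) \<le> c ^ 3 * (\<theta> n ^ 3 * (real n)\<^sup>2)"
              using n by (simp add: divide_le_eq mult_ac)
            hence "B\<^sup>2 * ln (real n) \<le> B\<^sup>2 * (c ^ 3 * (\<theta> n ^ 3 * (real n)\<^sup>2))"
              by (intro mult_left_mono) auto
            also have "\<dots> = (c ^ 3 * B\<^sup>2) * (\<theta> n ^ 3 * (real n)\<^sup>2)" by simp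
            also have "\<dots> \<le> \<kappa>\<^sup>2 * (\<theta> n ^ 3 * (real n)\<^sup>2)"
              using c3' \<theta> by (intro mult_right_mono) auto
            also have "\<dots> = (\<kappa> * \<theta> n)\<^sup>2 * ((real n)\<^sup>2 * \<theta> n)"
              by (simp add: power2_eq_square power3_eq_cube)
            also have "\<dots> \<le> (D n)\<^sup>2 * ((real n)\<^sup>2 * \<theta> n)"
              using D_ratio ratio elim(2) \<theta> \<kappa> by (intro mult_right_mono power_mono) auto
            finally show ?case by (simp add: B_def D_def mult.assoc)
          qed
        qed
      }
    }
    assume ratio: "\<forall>n\<ge>1. \<theta> n / \<rho> n \<le> C"
    \<comment> \<open>The second entry of both maxima, raised to the sixth power, is the composition
      condition.\<close>
    have rate1: "B\<^sup>2 * \<theta> n * ln (real n) \<le> (D n)\<^sup>2 * real n"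
      if n: "n \<ge> 1" and sep: "c * (\<theta> n - \<rho> n) >
          real n powr (- 1 / 6) * \<theta> n powr (5 / 6) * ln (real n) powr (1 / 6)" for n
    proof (rule gap_from_composition[where c = c and u = "\<theta> n - \<rho> n"])
      have \<theta>: "0 < \<theta> n" using par n by fastforce
      have "(real n powr (- 1 / 6) * \<theta> n powr (5 / 6) * ln (real n) powr (1 / 6)) ^ 6
          \<le> (c * (\<theta> n - \<rho> n)) ^ 6"
        using sep by (intro power_mono) auto
      moreover have "(real n powr (- 1 / 6)) ^ 6 = 1 / real n"
        using n by (subst powr_powr_power[where b = "-1"]) (auto simp: powr_minus_divide)
      moreover have "(\<theta> n powr (5 / 6)) ^ 6 = \<theta> n ^ 5"
        using \<theta> by (subst powr_powr_power[where b = 5]) (auto simp: powr_numeral)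
      moreover have "(ln (real n) powr (1 / 6)) ^ 6 = ln (real n)"
        using n by (subst powr_powr_power[where b = 1]) auto
      ultimately show "\<theta> n ^ 5 * ln (real n) \<le> (c * (\<theta> n - \<rho> n)) ^ 6 * real n"
        using n by (simp add: power_mult_distrib divide_le_eq)
      show "(\<theta> n - \<rho> n) ^ 3 \<le> k * (\<theta> n)\<^sup>2 * D n" by (rule u3[OF n])
    qed (use par n k1 c0 c3 B1 in \<open>auto intro: less_trans\<close>)
    {
      assume sep: "\<forall>\<^sub>F n in sequentially.
            c * (\<theta> n - \<rho> n) >
              max (real n powr (- 1 / 3) * \<theta> n powr (1 / 3))
                  (real n powr (- 1 / 6) * \<theta> n powr (5 / 6) * ln (real n) powr (1 / 6))"
      show "consistent_exact_recovery AWCD1_orig K \<theta> \<rho>"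
      proof (rule AWCD1_orig_consistentI[OF K1 C1 params[OF ratio]])
        show "\<forall>\<^sub>F n in sequentially. (rate_const K C)\<^sup>2 * \<theta> n * ln (real n) \<le>
            (density_gap K (\<theta> n) (\<rho> n))\<^sup>2 * real n"
          using sep eventually_ge_at_top[of 1]
          by eventually_elim (use rate1 in \<open>simp add: B_def D_def\<close>)
        show "\<forall>\<^sub>F n in sequentially. rate_const K C \<le> density_gap K (\<theta> n) (\<rho> n) * (real n * \<theta> n)"
          using sep eventually_ge_at_top[of 1]
        proof eventually_elim
          case (elim n)
          have \<theta>: "0 < \<theta> n" using par elim(2) by fastforce
          have "B \<le> D n * (real n * \<theta> n)"
          proof (rule gap_from_bias[where c = c and u = "\<theta> n - \<rho> n" and L = 0])
            \<comment> \<open>The first entry of the maximum controls the bias of the uncorrected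
              statistic.\<close>
            have "(real n powr (- 1 / 3) * \<theta> n powr (1 / 3)) ^ 3 \<le> (c * (\<theta> n - \<rho> n)) ^ 3"
              using elim(1) by (intro power_mono) auto
            moreover have "(real n powr (- 1 / 3)) ^ 3 = 1 / real n"
              using elim(2) by (subst powr_powr_power[where b = "-1"]) (auto simp: powr_minus_divide)
            moreover have "(\<theta> n powr (1 / 3)) ^ 3 = \<theta> n"
              using \<theta> by (subst powr_powr_power[where b = 1]) auto
            ultimately show "\<theta> n \<le> (c * (\<theta> n - \<rho> n)) ^ 3 * real n"
              using elim(2) by (simp add: power_mult_distrib divide_le_eq)
            show "(\<theta> n - \<rho> n) ^ 3 \<le> k * (\<theta> n)\<^sup>2 * D n" by (rule u3[OF elim(2)])
          qed (use par elim(2) k1 c0 c3 B1 \<theta> in auto)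
          thus ?case by (simp add: B_def D_def)
        qed
      qed
    }
    {
      assume sep: "\<forall>\<^sub>F n in sequentially.
            c * (\<theta> n - \<rho> n) >
              max (real n powr (- 1 / 3) * \<theta> n powr (1 / 2) * ln (real n) powr (1 / 6))
                  (real n powr (- 1 / 6) * \<theta> n powr (5 / 6) * ln (real n) powr (1 / 6))"
      show "consistent_exact_recovery AWCD1 K \<theta> \<rho>"
      proof (rule AWCD1_consistentI[OF K1 C1 params[OF ratio]])
        show "\<forall>\<^sub>F n in sequentially. (rate_const K C)\<^sup>2 * \<theta> n * ln (real n) \<le>
            (density_gap K (\<theta> n) (\<rho> n))\<^sup>2 * real n"
          using sep eventually_ge_at_top[of 1]
          by eventually_elim (use rate1 in \<open>simp add: B_def D_def\<close>)
        show "\<forall>\<^sub>F n in sequentially. (rate_const K C)\<^sup>2 * ln (real n) \<le>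
            (density_gap K (\<theta> n) (\<rho> n))\<^sup>2 * (real n)\<^sup>2 * \<theta> n"
          using sep eventually_ge_at_top[of 1]
        proof eventually_elim
          case (elim n)
          have \<theta>: "0 < \<theta> n" using par elim(2) by fastforce
          have "B\<^sup>2 * ln (real n) \<le> (D n)\<^sup>2 * (real n)\<^sup>2 * \<theta> n"
          proof (rule gap_from_sampling[where c = c and u = "\<theta> n - \<rho> n"])
            \<comment> \<open>Here the first entry of the maximum controls the sampling noise of the
              edges between the neighbourhoods.\<close>
            have "(real n powr (- 1 / 3) * \<theta> n powr (1 / 2) * ln (real n) powr (1 / 6)) ^ 6
                \<le> (c * (\<theta> n - \<rho> n)) ^ 6"
              using elim(1) by (intro power_mono) auto
            moreover have "(real n powr (- 1 / 3)) ^ 6 = 1 / (real n)\<^sup>2"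
              using elim(2) by (subst powr_powr_power[where b = "-2"]) (auto simp: powr_minus_divide powr_numeral)
            moreover have "(\<theta> n powr (1 / 2)) ^ 6 = \<theta> n ^ 3"
              using \<theta> by (subst powr_powr_power[where b = 3]) (auto simp: powr_numeral)
            moreover have "(ln (real n) powr (1 / 6)) ^ 6 = ln (real n)"
              using elim(2) by (subst powr_powr_power[where b = 1]) auto
            ultimately show "\<theta> n ^ 3 * ln (real n) \<le> (c * (\<theta> n - \<rho> n)) ^ 6 * (real n)\<^sup>2"
              using elim(2) by (simp add: power_mult_distrib divide_le_eq)
            show "(\<theta> n - \<rho> n) ^ 3 \<le> k * (\<theta> n)\<^sup>2 * D n" by (rule u3[OF elim(2)])
          qed (use par elim(2) k1 c0 c3 B1 \<theta> in auto)
          thus ?case by (simp add: B_def D_def)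
        qed
      qed
    }
  qed
qed

end
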